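(* Let $m,n\ge 3$ and let $P$ and $Q$ be disjoint (oriented) monotonic cycles of length $m$ and $n$, respectively, in $K_{m+n}$, and suppose that $P$ and $Q$ each have exactly $i$ interior edges, where $i\ge 2$. For every integer $\ell$, the proportion of random book embeddings of $K_{m+n}$ in which the linking number of $P\cup Q$ is equal to $\ell$ is $$\frac{A(2i-1,\,i+\ell-1)}{(2i-1)!}.$$
   Context: Circular diagram. For $N\ge 4$, the vertices $v_1,\dots,v_N$ of the complete graph $K_N$ are placed at $N$ distinct points of a circle in clockwise order. Edges joining consecutive vertices $v_j,v_{j+1}$ (indices mod $N$) are called exterior edges and are drawn as arcs of the circle. The remaining $\binom{N}{2}-N$ edges are called interior edges and are projected to straight chords. Random book embedding. Each interior edge is placed on its own sheet (a disc bounded by the circle). The height order of the sheets is given by a uniformly random permutation $\sigma$ of $\{1,\dots,\binom N2-N\}$: interior edge $e_a$ lies above interior edge $e_b$ iff $\sigma(a)>\sigma(b)$. This determines an embedding of $K_N$ in $\mathbb{R}^3$ up to equivalence. Probabilities, proportions and means are with respect to $\sigma$. Monotonic cycles. Cycles are simple cycles of length at least $3$. An oriented cycle with consecutive edges $\overrightarrow{v_{i_1}v_{i_2}},\dots,\overrightarrow{v_{i_{k-1}}v_{i_k}},\overrightarrow{v_{i_k}v_{i_1}}$ is strictly increasing (resp. strictly decreasing) if some cyclic permutation $i_1',\dots,i_k'$ of $i_1,\dots,i_k$ satisfies $i_j'<i_{j+1}'$ (resp. $i_j'>i_{j+1}'$) for all $1\le j\le k-1$. It is monotonic if it is strictly increasing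 or strictly decreasing. Two cycles are disjoint if they share no vertex. (Two disjoint monotonic cycles of lengths $m$ and $n$ in $K_{m+n}$ always have the same number of interior edges.) Linking number. For disjoint oriented cycles $P,Q$ and a given embedding, $\ell(P\cup Q)$ is half the sum of the signs of the crossings, in the circular diagram, between an edge of $P$ and an edge of $Q$ (two chords cross when they meet in their interiors; only interior edges can cross). A crossing has sign $+1$ if (direction of the over-edge, direction of the under-edge) is a positively oriented basis of the plane, and $-1$ otherwise. Eulerian numbers. An ascent of a permutation $\tau\in S_r$ is a value $1\le k\le r-1$ with $\tau(k)<\tau(k+1)$. The Eulerian number $A(r,s)$ is the number of $\tau\in S_r$ with exactly $s$ ascents (so $A(r,s)=0$ if $s<0$ or $s\ge r$, for $r\geq 1$). *)

theory Defs
  imports "HOL-Probability.Probability" "HOL-Combinatorics.Permutations"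
begin

text \<open>The vertices of \<open>K\<^sub>N\<close> are the numbers \<open>1, \<dots>, N\<close>; an (unoriented) edge is a two-element set of
  vertices, an oriented edge is a pair. An oriented cycle is given by the list of its vertices, read
  cyclically.\<close>

definition clockwise_on_circle :: "nat \<Rightarrow> (nat \<Rightarrow> complex) \<Rightarrow> bool" where
  "clockwise_on_circle N v \<longleftrightarrow>
     (\<exists>c r \<theta>. r > 0 \<and> strict_mono_on {1..N} \<theta> \<and> \<theta> N < \<theta> 1 + 2 * pi \<and>
        (\<forall>j\<in>{1..N}. v j = c + complex_of_real r * cis (- \<theta> j)))"

definition complete_edges :: "nat \<Rightarrow> nat set set" where
  "complete_edges N = {{a, b} | a b. a \<in> {1..N} \<and> b \<in> {1..N} \<and> a \<noteq> b}"

definition exterior_edges :: "nat \<Rightarrow> nat set set" where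
  "exterior_edges N = {{j, j mod N + 1} | j. j \<in> {1..N}}"

definition interior_edges :: "nat \<Rightarrow> nat set set" where
  "interior_edges N = complete_edges N - exterior_edges N"

definition num_interior :: "nat \<Rightarrow> nat" where
  "num_interior N = (N choose 2) - N"

definition is_cycle :: "nat \<Rightarrow> nat list \<Rightarrow> bool" where
  "is_cycle N c \<longleftrightarrow> 3 \<le> length c \<and> distinct c \<and> set c \<subseteq> {1..N}"

definition strictly_increasing_cycle :: "nat list \<Rightarrow> bool" where
  "strictly_increasing_cycle c \<longleftrightarrow> (\<exists>s. successively (<) (rotate s c))"

definition strictly_decreasing_cycle :: "nat list \<Rightarrow> bool" where
  "strictly_decreasing_cycle c \<longleftrightarrow> (\<exists>s. successively (>) (rotate s c))"

definition monotonic_cycle :: "nat list \<Rightarrow> bool" where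
  "monotonic_cycle c \<longleftrightarrow> strictly_increasing_cycle c \<or> strictly_decreasing_cycle c"

definition oriented_edges :: "nat list \<Rightarrow> (nat \<times> nat) set" where
  "oriented_edges c = {(c ! j, c ! (Suc j mod length c)) | j. j < length c}"

definition unoriented :: "nat \<times> nat \<Rightarrow> nat set" where
  "unoriented d = {fst d, snd d}"

definition cycle_interior_edges :: "nat \<Rightarrow> nat list \<Rightarrow> nat set set" where
  "cycle_interior_edges N c = unoriented ` oriented_edges c \<inter> interior_edges N"

text \<open>A book embedding is described by the enumeration \<open>e\<close> of the interior edges and the permutation
  \<open>\<sigma>\<close> that determines the height order of their sheets.\<close>

definition lies_above :: "nat \<Rightarrow> (nat \<Rightarrow> nat set) \<Rightarrow> (nat \<Rightarrow> nat) \<Rightarrow> nat set \<Rightarrow> nat set \<Rightarrow> bool" where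
  "lies_above N e \<sigma> A B \<longleftrightarrow>
     (\<exists>a\<in>{1..num_interior N}. \<exists>b\<in>{1..num_interior N}. A = e a \<and> B = e b \<and> \<sigma> a > \<sigma> b)"

definition edge_direction :: "(nat \<Rightarrow> complex) \<Rightarrow> nat \<times> nat \<Rightarrow> complex" where
  "edge_direction v d = v (snd d) - v (fst d)"

definition chords_cross :: "(nat \<Rightarrow> complex) \<Rightarrow> nat \<times> nat \<Rightarrow> nat \<times> nat \<Rightarrow> bool" where
  "chords_cross v d f \<longleftrightarrow>
     open_segment (v (fst d)) (v (snd d)) \<inter> open_segment (v (fst f)) (v (snd f)) \<noteq> {}"

definition positively_oriented :: "complex \<Rightarrow> complex \<Rightarrow> bool" where
  "positively_oriented x y \<longleftrightarrow> Re x * Im y - Im x * Re y > 0"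

text \<open>The first oriented edge is the over-edge.\<close>

definition over_under_sign :: "(nat \<Rightarrow> complex) \<Rightarrow> nat \<times> nat \<Rightarrow> nat \<times> nat \<Rightarrow> int" where
  "over_under_sign v d f =
     (if positively_oriented (edge_direction v d) (edge_direction v f) then 1 else -1)"

definition crossing_sign ::
  "(nat \<Rightarrow> complex) \<Rightarrow> (nat set \<Rightarrow> nat set \<Rightarrow> bool) \<Rightarrow> nat \<times> nat \<Rightarrow> nat \<times> nat \<Rightarrow> int" where
  "crossing_sign v higher d f =
     (if higher (unoriented d) (unoriented f) then over_under_sign v d f else over_under_sign v f d)"

definition cycle_crossings ::
  "nat \<Rightarrow> (nat \<Rightarrow> complex) \<Rightarrow> nat list \<Rightarrow> nat list \<Rightarrow> ((nat \<times> nat) \<times> (nat \<times> nat)) set" where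
  "cycle_crossings N v P Q =
     {(d, f). d \<in> oriented_edges P \<and> f \<in> oriented_edges Q \<and>
        unoriented d \<in> interior_edges N \<and> unoriented f \<in> interior_edges N \<and> chords_cross v d f}"

text \<open>Real-valued, so that halving does not truncate.\<close>

definition linking_number ::
  "nat \<Rightarrow> (nat \<Rightarrow> complex) \<Rightarrow> (nat set \<Rightarrow> nat set \<Rightarrow> bool) \<Rightarrow> nat list \<Rightarrow> nat list \<Rightarrow> real" where
  "linking_number N v higher P Q =
     real_of_int (\<Sum>(d, f)\<in>cycle_crossings N v P Q. crossing_sign v higher d f) / 2"

definition height_permutations :: "nat \<Rightarrow> (nat \<Rightarrow> nat) set" where
  "height_permutations N = {\<sigma>. \<sigma> permutes {1..num_interior N}}"

definition ascents :: "nat \<Rightarrow> (nat \<Rightarrow> nat) \<Rightarrow> nat set" where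
  "ascents r \<tau> = {k. 1 \<le> k \<and> k \<le> r - 1 \<and> \<tau> k < \<tau> (k + 1)}"

definition eulerian :: "nat \<Rightarrow> int \<Rightarrow> nat" where
  "eulerian r s = card {\<tau>. \<tau> permutes {1..r} \<and> int (card (ascents r \<tau>)) = s}"

end

theory Submission imports Defs begin

text \<open>The two cycles use all vertices of \<open>K\<^sub>N\<close>, so they colour the circle with two colours. Let
  \<open>d\<^sub>1 < \<dots> < d\<^sub>R\<close> be the vertices whose clockwise neighbour has the other colour. An interior edge
  of an increasing cycle leaves a block of its own colour at some \<open>d\<^sub>j\<close>, jumps over one block of the
  other colour, which ends at \<open>d\<^sub>j\<^sub>+\<^sub>1\<close>, and lands on the clockwise neighbour of \<open>d\<^sub>j\<^sub>+\<^sub>1\<close>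
  (\<open>interior_gaps\<close>). Call this chord \<open>c\<^sub>j\<close>; indices are cyclic. Hence the chords of the two cycles
  alternate, \<open>R = 2 * i\<close>, and a chord of one cycle crosses a chord of the other precisely when their
  indices are cyclically adjacent (\<open>cross_chord\<close>). All crossings of \<open>c\<^sub>j\<close> with \<open>c\<^sub>j\<^sub>+\<^sub>1\<close> look alike up
  to rotation, so that the sign is \<open>-1\<close> if \<open>c\<^sub>j\<close> is the higher chord and \<open>+1\<close> otherwise.

  Therefore, for increasing cycles, twice the linking number is the number of cyclic ascents minus the
  number of cyclic descents of the heights of \<open>c\<^sub>1, \<dots>, c\<^sub>2\<^sub>i\<close>, and the linking number itself is
  the number of cyclic ascents minus \<open>i\<close> (\<open>crossing_sum_chord\<close>). Reversing one cycle only changes the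
  sign (\<open>linking_number_monotonic\<close>).

  It remains to count. The relative order of the heights of \<open>2 * i\<close> fixed chords is a uniformly
  random permutation. Cutting a cyclic arrangement of \<open>r + 1\<close> distinct heights at its maximum leaves a
  linear arrangement of \<open>r\<close> heights with exactly one ascent fewer, the lost one being the ascent into
  the maximum. So \<open>k\<close> cyclic ascents occur with probability \<open>A(r, k - 1) / r!\<close>
  (\<open>prob_cyclic_ascents\<close>), which gives the claim for \<open>r = 2 * i - 1\<close> and \<open>k = i + \<ell>\<close>. For
  the opposite sign, \<open>k = i - \<ell>\<close>, and the symmetry \<open>A(r, t) = A(r, r - 1 - t)\<close>
  (\<open>eulerian_symmetric\<close>) yields the same value.\<close>

section \<open>Cyclic ascents and Eulerian numbers\<close>

definition cyclic_succ :: "nat \<Rightarrow> nat \<Rightarrow> nat" where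
  "cyclic_succ N x = x mod N + 1"

lemma cyclic_succ_less: "1 \<le> x \<Longrightarrow> x < N \<Longrightarrow> cyclic_succ N x = x + 1"
  by (simp add: cyclic_succ_def)

lemma cyclic_succ_last [simp]: "cyclic_succ N N = 1"
  by (simp add: cyclic_succ_def)

lemma cyclic_succ_in: "x \<in> {1..N} \<Longrightarrow> cyclic_succ N x \<in> {1..N}"
  by (cases "x = N") (auto simp: cyclic_succ_less)

lemma inj_on_cyclic_succ: "inj_on (cyclic_succ N) {1..N}"
proof (rule inj_onI)
  fix x y assume "x \<in> {1..N}" "y \<in> {1..N}" "cyclic_succ N x = cyclic_succ N y"
  then show "x = y"
    by (cases "x = N"; cases "y = N") (auto simp: cyclic_succ_less)
qed

lemma bij_betw_cyclic_succ: "bij_betw (cyclic_succ N) {1..N} {1..N}"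
  using inj_on_cyclic_succ endo_inj_surj[of "{1..N}" "cyclic_succ N"] cyclic_succ_in
  by (auto simp: bij_betw_def image_subset_iff)

definition cyclic_ascents :: "nat \<Rightarrow> (nat \<Rightarrow> nat) \<Rightarrow> nat set" where
  "cyclic_ascents R g = {j \<in> {1..R}. g j < g (cyclic_succ R j)}"

definition rotation :: "nat \<Rightarrow> nat \<Rightarrow> nat" where
  "rotation R j = (if j \<in> {1..R} then cyclic_succ R j else j)"

lemma rotation_permutes: "rotation R permutes {1..R}"
proof (rule bij_imp_permutes)
  show "bij_betw (rotation R) {1..R} {1..R}"
    using bij_betw_cyclic_succ by (rule bij_betw_cong[THEN iffD1, rotated]) (simp add: rotation_def)
qed (auto simp: rotation_def)

lemma card_cyclic_ascents_rotation:
  "card (cyclic_ascents R (g \<circ> rotation R)) = card (cyclic_ascents R g)"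
proof -
  have "cyclic_succ R ` cyclic_ascents R (g \<circ> rotation R) = cyclic_ascents R g"
  proof (intro equalityI subsetI)
    fix y assume y: "y \<in> cyclic_ascents R g"
    then have "y \<in> cyclic_succ R ` {1..R}"
      using bij_betw_cyclic_succ by (auto simp: cyclic_ascents_def bij_betw_def)
    then obtain x where "x \<in> {1..R}" "y = cyclic_succ R x" by blast
    with y show "y \<in> cyclic_succ R ` cyclic_ascents R (g \<circ> rotation R)"
      using cyclic_succ_in[of x R] by (auto simp: cyclic_ascents_def rotation_def)
  qed (use cyclic_succ_in in \<open>auto simp: cyclic_ascents_def rotation_def split: if_splits\<close>)
  moreover have "inj_on (cyclic_succ R) (cyclic_ascents R (g \<circ> rotation R))"
    by (rule inj_on_subset[OF inj_on_cyclic_succ]) (auto simp: cyclic_ascents_def)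
  ultimately show ?thesis by (metis card_image)
qed

lemma card_permutes_compose_right:
  assumes "\<pi> permutes S"
  shows "card {\<sigma>. \<sigma> permutes S \<and> Q (\<sigma> \<circ> \<pi>)} = card {\<sigma>. \<sigma> permutes S \<and> Q \<sigma>}"
proof (rule bij_betw_same_card)
  have "\<sigma> \<circ> \<pi> \<circ> inv \<pi> = \<sigma>" "\<sigma> \<circ> inv \<pi> \<circ> \<pi> = \<sigma>" for \<sigma> :: "'a \<Rightarrow> 'a"
    using permutes_inverses[OF assms] by (simp_all add: fun_eq_iff)
  then show "bij_betw (\<lambda>\<sigma>. \<sigma> \<circ> \<pi>) {\<sigma>. \<sigma> permutes S \<and> Q (\<sigma> \<circ> \<pi>)} {\<sigma>. \<sigma> permutes S \<and> Q \<sigma>}"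
    using permutes_compose[OF assms] permutes_compose[OF permutes_inv[OF assms]]
    by (intro bij_betw_byWitness[where f' = "\<lambda>\<sigma>. \<sigma> \<circ> inv \<pi>"]) (simp_all add: image_subset_iff)
qed

lemma card_permutes_compose_left:
  assumes "\<pi> permutes S"
  shows "card {\<sigma>. \<sigma> permutes S \<and> Q (\<pi> \<circ> \<sigma>)} = card {\<sigma>. \<sigma> permutes S \<and> Q \<sigma>}"
proof (rule bij_betw_same_card)
  have "inv \<pi> \<circ> (\<pi> \<circ> \<sigma>) = \<sigma>" "\<pi> \<circ> (inv \<pi> \<circ> \<sigma>) = \<sigma>" for \<sigma> :: "'a \<Rightarrow> 'a"
    using permutes_inverses[OF assms] by (simp_all add: fun_eq_iff)
  then show "bij_betw (\<lambda>\<sigma>. \<pi> \<circ> \<sigma>) {\<sigma>. \<sigma> permutes S \<and> Q (\<pi> \<circ> \<sigma>)} {\<sigma>. \<sigma> permutes S \<and> Q \<sigma>}"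
    using permutes_compose[OF _ assms] permutes_compose[OF _ permutes_inv[OF assms]]
    by (intro bij_betw_byWitness[where f' = "\<lambda>\<sigma>. inv \<pi> \<circ> \<sigma>"]) (simp_all add: image_subset_iff)
qed

definition cyclic_class :: "nat \<Rightarrow> int \<Rightarrow> (nat \<Rightarrow> nat) set" where
  "cyclic_class R k = {\<tau>. \<tau> permutes {1..R} \<and> int (card (cyclic_ascents R \<tau>)) = k}"

lemma finite_cyclic_class [simp]: "finite (cyclic_class R k)"
  unfolding cyclic_class_def by (rule finite_subset[OF _ finite_permutations[of "{1..R}"]]) auto

text \<open>Rotating an arrangement preserves its cyclic ascents and moves the maximum by one place, so
  the position of the maximum is independent of their number.\<close>
lemma card_cyclic_class_shift:
  assumes "p \<in> {1..<R}"
  shows "card {\<tau> \<in> cyclic_class R k. \<tau> p = R} = card {\<tau> \<in> cyclic_class R k. \<tau> (Suc p) = R}"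
proof -
  have rp: "rotation R p = Suc p" using assms by (simp add: rotation_def cyclic_succ_less)
  have "card {\<tau>. \<tau> permutes {1..R} \<and> (int (card (cyclic_ascents R \<tau>)) = k \<and> \<tau> (Suc p) = R)}
    = card {\<tau>. \<tau> permutes {1..R} \<and> (int (card (cyclic_ascents R \<tau>)) = k \<and> \<tau> p = R)}"
    using card_permutes_compose_right[OF rotation_permutes, where R1 = R and
        Q = "\<lambda>\<tau>. int (card (cyclic_ascents R \<tau>)) = k \<and> \<tau> p = R"]
    by (simp add: card_cyclic_ascents_rotation rp)
  then show ?thesis by (simp add: cyclic_class_def)
qed

text \<open>A permutation of \<open>{1..r}\<close> fixes \<open>r + 1\<close>, so as an arrangement of length \<open>r + 1\<close> it has its
  maximum in the last place. The step into the maximum is then a cyclic ascent, the step out of it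
  is not, and all other steps are those of the linear arrangement.\<close>
lemma card_cyclic_ascents_max_last:
  assumes "\<tau> permutes {1..r}" "1 \<le> r"
  shows "card (cyclic_ascents (Suc r) \<tau>) = Suc (card (ascents r \<tau>))"
proof -
  have l: "\<tau> (Suc r) = Suc r" using assms(1) by (auto simp: permutes_def)
  have le: "\<tau> j \<le> r" if "j \<in> {1..r}" for j
    using permutes_in_image[OF assms(1), of j] that by auto
  have "j \<in> cyclic_ascents (Suc r) \<tau> \<longleftrightarrow> j \<in> insert r (ascents r \<tau>)" for j
  proof -
    consider "j \<in> {1..<r}" | "j = r" | "j = Suc r" | "j \<notin> {1..Suc r}" by force
    then show ?thesis
    proof cases
      case 1
      then show ?thesis by (auto simp: cyclic_ascents_def ascents_def cyclic_succ_less)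
    next
      case 2
      then show ?thesis using assms(2) l le[of r] by (simp add: cyclic_ascents_def cyclic_succ_less)
    next
      case 3
      then show ?thesis using assms(2) l le[of 1] by (auto simp: cyclic_ascents_def ascents_def)
    next
      case 4
      then show ?thesis using assms(2) by (auto simp: cyclic_ascents_def ascents_def)
    qed
  qed
  then have "cyclic_ascents (Suc r) \<tau> = insert r (ascents r \<tau>)" by blast
  moreover have "r \<notin> ascents r \<tau>" "finite (ascents r \<tau>)"
    using assms(2) by (auto simp: ascents_def)
  ultimately show ?thesis by simp
qed

text \<open>Each of the \<open>r + 1\<close> possible positions of the maximum contributes as much as the last one.\<close>
lemma card_cyclic_class:
  assumes "1 \<le> r"
  shows "card (cyclic_class (Suc r) k) = Suc r * eulerian r (k - 1)"
proof -
  let ?R = "Suc r"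
  let ?X = "\<lambda>p. {\<tau> \<in> cyclic_class ?R k. \<tau> p = ?R}"
  have const: "card (?X p) = card (?X ?R)" if "p \<in> {1..?R}" for p
  proof -
    have "p \<le> ?R" using that by simp
    then show ?thesis using that
    proof (induction rule: inc_induct)
      case (step q)
      then show ?case using card_cyclic_class_shift[of q ?R k] by simp
    qed simp
  qed
  have "?X ?R = {\<tau>. \<tau> permutes {1..r} \<and> int (card (ascents r \<tau>)) = k - 1}"
  proof -
    have eq: "\<tau> permutes {1..?R} \<and> \<tau> ?R = ?R \<longleftrightarrow> \<tau> permutes {1..r}" for \<tau>
    proof
      assume *: "\<tau> permutes {1..?R} \<and> \<tau> ?R = ?R"
      show "\<tau> permutes {1..r}"
      proof (rule permutes_superset)
        show "\<tau> permutes {1..?R}" using * ..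
        show "\<tau> x = x" if "x \<in> {1..?R} - {1..r}" for x
          using that * by (cases "x = ?R") auto
      qed
    next
      assume "\<tau> permutes {1..r}"
      then show "\<tau> permutes {1..?R} \<and> \<tau> ?R = ?R"
        using permutes_subset[of \<tau> "{1..r}" "{1..?R}"] permutes_not_in[of \<tau> "{1..r}" ?R] by auto
    qed
    show ?thesis
      using eq card_cyclic_ascents_max_last[OF _ assms]
      by (fastforce simp: cyclic_class_def simp del: One_nat_def)
  qed
  then have last: "card (?X ?R) = eulerian r (k - 1)" by (simp add: eulerian_def)
  have "cyclic_class ?R k = (\<Union>p\<in>{1..?R}. ?X p)"
  proof (intro equalityI subsetI)
    fix \<tau> assume t: "\<tau> \<in> cyclic_class ?R k"
    then have p: "\<tau> permutes {1..?R}" by (simp add: cyclic_class_def)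
    then have "?R \<in> \<tau> ` {1..?R}" by (simp only: permutes_image) simp
    with t show "\<tau> \<in> (\<Union>p\<in>{1..?R}. ?X p)" by auto
  qed auto
  also have "card \<dots> = (\<Sum>p\<in>{1..?R}. card (?X p))"
  proof (rule card_UN_disjoint)
    have "i = j" if "\<tau> \<in> ?X i" "\<tau> \<in> ?X j" for i j \<tau>
    proof -
      have "inj \<tau>" using that(1) by (auto simp: cyclic_class_def intro: permutes_inj)
      then show ?thesis using that injD[of \<tau> i j] by simp
    qed
    then show "\<forall>i\<in>{1..?R}. \<forall>j\<in>{1..?R}. i \<noteq> j \<longrightarrow> ?X i \<inter> ?X j = {}" by blast
  qed auto
  also have "\<dots> = Suc r * eulerian r (k - 1)"
    using const last by simp
  finally show ?thesis .
qed

text \<open>Replacing every value \<open>t\<close> by \<open>r + 1 - t\<close> exchanges ascents and descents.\<close>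
lemma eulerian_symmetric:
  assumes "1 \<le> r"
  shows "eulerian r s = eulerian r (int r - 1 - s)"
proof -
  let ?S = "\<lambda>s. {\<tau>. \<tau> permutes {1..r} \<and> int (card (ascents r \<tau>)) = s}"
  define c where "c \<tau> j = (if j \<in> {1..r} then Suc r - \<tau> j else j)" for \<tau> :: "nat \<Rightarrow> nat" and j
  have rng: "\<tau> j \<in> {1..r}" if "\<tau> permutes {1..r}" "j \<in> {1..r}" for \<tau> j
    using permutes_in_image[OF that(1)] that(2) by blast
  have perm: "c \<tau> permutes {1..r}" if t: "\<tau> permutes {1..r}" for \<tau>
  proof (rule bij_imp_permutes)
    have "inj_on (c \<tau>) {1..r}"
    proof (rule inj_onI)
      fix x y assume xy: "x \<in> {1..r}" "y \<in> {1..r}" "c \<tau> x = c \<tau> y"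
      then have "\<tau> x = \<tau> y" using rng[OF t xy(1)] rng[OF t xy(2)] by (auto simp: c_def)
      then show "x = y" using permutes_inj[OF t] by (simp add: inj_eq)
    qed
    moreover have "c \<tau> ` {1..r} \<subseteq> {1..r}" using rng[OF t] by (fastforce simp: c_def)
    ultimately show "bij_betw (c \<tau>) {1..r} {1..r}"
      by (simp add: bij_betw_def endo_inj_surj)
  qed (auto simp: c_def)
  have asc: "int (card (ascents r (c \<tau>))) = int r - 1 - int (card (ascents r \<tau>))"
    if t: "\<tau> permutes {1..r}" for \<tau>
  proof -
    have "k \<in> ascents r (c \<tau>) \<longleftrightarrow> k \<in> {1..r - 1} - ascents r \<tau>" for k
    proof (cases "k \<in> {1..r - 1}")
      case True
      then have k: "k \<in> {1..r}" "Suc k \<in> {1..r}" by auto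
      moreover have "\<tau> k \<noteq> \<tau> (Suc k)" using permutes_inj[OF t] by (simp add: inj_eq)
      ultimately show ?thesis using True rng[OF t k(1)] rng[OF t k(2)]
        by (auto simp: ascents_def c_def)
    qed (auto simp: ascents_def)
    then have "ascents r (c \<tau>) = {1..r - 1} - ascents r \<tau>" by blast
    moreover have "ascents r \<tau> \<subseteq> {1..r - 1}" by (auto simp: ascents_def)
    ultimately have "card (ascents r (c \<tau>)) + card (ascents r \<tau>) = r - 1"
      by (metis card_Diff_subset card_atLeastAtMost card_mono diff_Suc_1 finite_atLeastAtMost
          finite_subset le_add_diff_inverse2)
    then show ?thesis using assms by linarith
  qed
  have inv: "c (c \<tau>) = \<tau>" if t: "\<tau> permutes {1..r}" for \<tau>
  proof
    fix j show "c (c \<tau>) j = \<tau> j"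
      using rng[OF t, of j] permutes_not_in[OF t, of j] by (cases "j \<in> {1..r}") (auto simp: c_def)
  qed
  have "bij_betw c (?S s) (?S (int r - 1 - s))"
    by (rule bij_betw_byWitness[where f' = c]) (auto simp: inv perm asc simp del: One_nat_def)
  then show ?thesis unfolding eulerian_def by (rule bij_betw_same_card)
qed

text \<open>The standardisation of \<open>g\<close>: every value is replaced by its rank.\<close>
lemma order_pattern_exists:
  fixes g :: "nat \<Rightarrow> nat"
  assumes "inj_on g {1..R}"
  obtains \<rho> where "\<rho> permutes {1..R}"
    and "\<And>j k. j \<in> {1..R} \<Longrightarrow> k \<in> {1..R} \<Longrightarrow> \<rho> j < \<rho> k \<longleftrightarrow> g j < g k"
proof -
  define \<rho> where "\<rho> j = (if j \<in> {1..R} then card {k \<in> {1..R}. g k \<le> g j} else j)" for j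
  have mono: "\<rho> j < \<rho> k" if "j \<in> {1..R}" "k \<in> {1..R}" "g j < g k" for j k
  proof -
    have "{i \<in> {1..R}. g i \<le> g j} \<subseteq> {i \<in> {1..R}. g i \<le> g k}" using that by auto
    moreover have "k \<in> {i \<in> {1..R}. g i \<le> g k}" "k \<notin> {i \<in> {1..R}. g i \<le> g j}"
      using that by auto
    ultimately have "{i \<in> {1..R}. g i \<le> g j} \<subset> {i \<in> {1..R}. g i \<le> g k}" by blast
    then show ?thesis using that by (simp add: \<rho>_def psubset_card_mono)
  qed
  have iff: "\<rho> j < \<rho> k \<longleftrightarrow> g j < g k" if "j \<in> {1..R}" "k \<in> {1..R}" for j k
    using mono[OF that] mono[OF that(2,1)] inj_onD[OF assms _ that]
    by (metis less_asym less_irrefl linorder_less_linear)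
  have "\<rho> permutes {1..R}"
  proof (rule bij_imp_permutes)
    have "inj_on \<rho> {1..R}"
      by (rule inj_onI) (metis iff inj_onD[OF assms] less_irrefl linorder_less_linear)
    moreover have "\<rho> ` {1..R} \<subseteq> {1..R}"
    proof (rule image_subsetI)
      fix j assume j: "j \<in> {1..R}"
      then have "card {j} \<le> card {k \<in> {1..R}. g k \<le> g j}" by (intro card_mono) auto
      moreover have "card {k \<in> {1..R}. g k \<le> g j} \<le> card {1..R}" by (intro card_mono) auto
      ultimately show "\<rho> j \<in> {1..R}" using j by (simp add: \<rho>_def)
    qed
    ultimately show "bij_betw \<rho> {1..R} {1..R}" by (simp add: bij_betw_def endo_inj_surj)
  qed (auto simp: \<rho>_def)
  then show ?thesis using iff that by blast
qed

lemma card_cyclic_arrangements: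
  assumes "inj_on g {1..R}"
  shows "card {\<tau>. \<tau> permutes {1..R} \<and> int (card (cyclic_ascents R (g \<circ> \<tau>))) = k}
    = card (cyclic_class R k)"
proof -
  obtain \<rho> where r: "\<rho> permutes {1..R}"
    and iff: "\<And>j k. j \<in> {1..R} \<Longrightarrow> k \<in> {1..R} \<Longrightarrow> \<rho> j < \<rho> k \<longleftrightarrow> g j < g k"
    using order_pattern_exists[OF assms] by metis
  have eq: "cyclic_ascents R (g \<circ> \<tau>) = cyclic_ascents R (\<rho> \<circ> \<tau>)" if "\<tau> permutes {1..R}" for \<tau>
  proof -
    have "\<tau> j \<in> {1..R} \<and> \<tau> (cyclic_succ R j) \<in> {1..R}" if "j \<in> {1..R}" for j
      using that cyclic_succ_in[OF that] permutes_in_image[OF \<open>\<tau> permutes {1..R}\<close>] by blast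
    then show ?thesis using iff by (auto simp: cyclic_ascents_def)
  qed
  have "{\<tau>. \<tau> permutes {1..R} \<and> int (card (cyclic_ascents R (g \<circ> \<tau>))) = k}
    = {\<tau>. \<tau> permutes {1..R} \<and> int (card (cyclic_ascents R (\<rho> \<circ> \<tau>))) = k}"
    using eq by auto
  then show ?thesis
    using card_permutes_compose_left[OF r, of "\<lambda>\<tau>. int (card (cyclic_ascents R \<tau>)) = k"]
    by (simp add: cyclic_class_def)
qed

text \<open>The order pattern of \<open>\<sigma>\<close> at \<open>R\<close> chosen places is uniform. The proof is by double counting of
  pairs \<open>(\<sigma>, \<tau>)\<close>, where \<open>\<tau>\<close> permutes the chosen places before \<open>\<sigma>\<close> is applied: for fixed \<open>\<tau>\<close> this
  only reindexes the \<open>\<sigma>\<close>, and for fixed \<open>\<sigma>\<close> all \<open>R!\<close> arrangements of the \<open>R\<close> distinct values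
  occur.\<close>
lemma card_permutations_cyclic_ascents:
  assumes b: "inj_on b {1..R}" "b ` {1..R} \<subseteq> {1..M}"
  shows "fact R * card {\<sigma>. \<sigma> permutes {1..M} \<and> int (card (cyclic_ascents R (\<sigma> \<circ> b))) = k}
    = fact M * card (cyclic_class R k)"
proof -
  let ?B = "b ` {1..R}"
  let ?PM = "{\<sigma>. \<sigma> permutes {1..M}}" and ?PR = "{\<tau>. \<tau> permutes {1..R}}"
  let ?ca = "\<lambda>g. int (card (cyclic_ascents R g))"
  have fin: "finite ?PM" "finite ?PR" by (simp_all add: finite_permutations)
  have bb: "bij_betw b {1..R} ?B" using b(1) by (simp add: bij_betw_def)
  have eq: "card {\<sigma> \<in> ?PM. ?ca (\<sigma> \<circ> b \<circ> \<tau>) = k} = card {\<sigma> \<in> ?PM. ?ca (\<sigma> \<circ> b) = k}"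
    if t: "\<tau> \<in> ?PR" for \<tau>
  proof -
    \<comment> \<open>The permutation \<open>\<tau>\<close> of the index set, transported along \<open>b\<close> to the chosen places.\<close>
    define t' where "t' = (\<lambda>x. if x \<in> ?B then b (\<tau> (inv_into {1..R} b x)) else x)"
    have "t' permutes ?B" unfolding t'_def using permutes_bij_inv_into[OF _ bb] t by blast
    then have t'M: "t' permutes {1..M}" using b(2) by (rule permutes_subset)
    have t'b: "t' (b j) = b (\<tau> j)" if "j \<in> {1..R}" for j
      using that b(1) by (simp add: t'_def inv_into_f_f)
    have ca: "cyclic_ascents R (\<sigma> \<circ> t' \<circ> b) = cyclic_ascents R (\<sigma> \<circ> b \<circ> \<tau>)" for \<sigma> :: "nat \<Rightarrow> nat"
      using t'b cyclic_succ_in[of _ R] by (auto simp: cyclic_ascents_def)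
    have "card {\<sigma>. \<sigma> permutes {1..M} \<and> ?ca (\<sigma> \<circ> t' \<circ> b) = k}
        = card {\<sigma>. \<sigma> permutes {1..M} \<and> ?ca (\<sigma> \<circ> b) = k}"
      using card_permutes_compose_right[OF t'M, of "\<lambda>\<sigma>. ?ca (\<sigma> \<circ> b) = k"] .
    then show ?thesis by (simp add: ca)
  qed
  have "fact R * card {\<sigma> \<in> ?PM. ?ca (\<sigma> \<circ> b) = k}
      = (\<Sum>\<tau>\<in>?PR. card {\<sigma> \<in> ?PM. ?ca (\<sigma> \<circ> b \<circ> \<tau>) = k})"
    by (simp only: eq sum_constant cong: sum.cong) (simp add: card_permutations[of _ R])
  also have "\<dots> = card (cyclic_class R k) * card ?PM"
  proof (rule sum_multicount[OF fin(2,1)], rule ballI)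
    fix \<sigma> assume "\<sigma> \<in> ?PM"
    then have "inj_on (\<sigma> \<circ> b) {1..R}"
      using comp_inj_on[OF b(1), of \<sigma>] permutes_inj_on[of \<sigma> "{1..M}"] by blast
    from card_cyclic_arrangements[OF this, of k]
    show "card {\<tau> \<in> ?PR. ?ca (\<sigma> \<circ> b \<circ> \<tau>) = k} = card (cyclic_class R k)" by simp
  qed
  also have "\<dots> = fact M * card (cyclic_class R k)" by (simp add: card_permutations[of _ M])
  finally show ?thesis by simp
qed

lemma prob_cyclic_ascents:
  assumes "inj_on b {1..Suc r}" "b ` {1..Suc r} \<subseteq> {1..M}" "1 \<le> r"
  shows "measure_pmf.prob (pmf_of_set {\<sigma>. \<sigma> permutes {1..M}})
      {\<sigma>. int (card (cyclic_ascents (Suc r) (\<sigma> \<circ> b))) = k} = real (eulerian r (k - 1)) / fact r"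
proof -
  let ?S = "{\<sigma>. \<sigma> permutes {1..M} \<and> int (card (cyclic_ascents (Suc r) (\<sigma> \<circ> b))) = k}"
  have "fact (Suc r) * card ?S = fact M * (Suc r * eulerian r (k - 1))"
    using card_permutations_cyclic_ascents[OF assms(1,2), of k] card_cyclic_class[OF assms(3), of k]
    by simp
  then have "Suc r * (fact r * card ?S) = Suc r * (fact M * eulerian r (k - 1))"
    by (simp add: algebra_simps)
  then have "fact r * card ?S = fact M * eulerian r (k - 1)"
    by (simp only: mult_cancel1) simp
  then have "real (fact r * card ?S) = real (fact M * eulerian r (k - 1))" by (rule arg_cong)
  then have *: "fact r * real (card ?S) = fact M * real (eulerian r (k - 1))" by simp
  have "id \<in> {\<sigma>. \<sigma> permutes {1..M}}" by (simp add: permutes_id)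
  then have "{\<sigma>. \<sigma> permutes {1..M}} \<noteq> {}" by blast
  then have "measure_pmf.prob (pmf_of_set {\<sigma>. \<sigma> permutes {1..M}})
      {\<sigma>. int (card (cyclic_ascents (Suc r) (\<sigma> \<circ> b))) = k}
      = real (card ?S) / real (card {\<sigma>. \<sigma> permutes {1..M}})"
    by (subst measure_pmf_of_set) (simp_all add: finite_permutations Collect_conj_eq)
  also have "\<dots> = real (card ?S) / fact M" by (simp add: card_permutations[of _ M])
  also have "\<dots> = real (eulerian r (k - 1)) / fact r"
    using * by (simp add: field_simps)
  finally show ?thesis .
qed

section \<open>Chords of the circular diagram\<close>

text \<open>The cyclic order of the vertices on the circle: \<open>y\<close> is met strictly between \<open>x\<close> and \<open>z\<close> when one
  walks clockwise from \<open>x\<close> to \<open>z\<close>.\<close>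
definition clockwise :: "nat \<Rightarrow> nat \<Rightarrow> nat \<Rightarrow> bool" where
  "clockwise x y z \<longleftrightarrow> x < y \<and> y < z \<or> y < z \<and> z < x \<or> z < x \<and> x < y"

lemma clockwise_swap:
  "x \<noteq> y \<Longrightarrow> y \<noteq> z \<Longrightarrow> x \<noteq> z \<Longrightarrow> clockwise x z y \<longleftrightarrow> \<not> clockwise x y z"
  by (auto simp: clockwise_def)

lemma clockwise_rotate: "clockwise x y z \<longleftrightarrow> clockwise y z x"
  by (auto simp: clockwise_def)

lemma clockwise_distinct: "clockwise x y z \<Longrightarrow> x \<noteq> y \<and> y \<noteq> z \<and> x \<noteq> z"
  by (auto simp: clockwise_def)

text \<open>The determinant of two plane vectors, that is, the oriented area of the parallelogram that they
  span. Crossings and their signs are read off from it.\<close>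
definition signed_area :: "complex \<Rightarrow> complex \<Rightarrow> real" where
  "signed_area x y = Re x * Im y - Im x * Re y"

lemma positively_oriented_iff: "positively_oriented x y \<longleftrightarrow> signed_area x y > 0"
  by (simp add: positively_oriented_def signed_area_def)

text \<open>Twice the oriented area of a triangle inscribed in a circle, in terms of its central angles.
  The half angles stay in \<open>(0, \<pi>)\<close> for vertices in clockwise order, which determines the sign.\<close>
lemma inscribed_triangle_area:
  "signed_area ((c + of_real r * cis (- b)) - (c + of_real r * cis (- a)))
      ((c + of_real r * cis (- d)) - (c + of_real r * cis (- a)))
    = - 4 * r\<^sup>2 * (sin ((b - a) / 2) * sin ((d - b) / 2) * sin ((d - a) / 2))"
proof -
  define A B D where "A = a / 2" and "B = b / 2" and "D = d / 2"
  have abd: "a = 2 * A" "b = 2 * B" "d = 2 * D" by (simp_all add: A_def B_def D_def)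
  have c: "cos (2 * x) - cos (2 * y) = - 2 * sin (x + y) * sin (x - y)" for x y :: real
    using cos_add[of "x + y" "x - y"] cos_diff[of "x + y" "x - y"] by simp
  have s: "sin (2 * x) - sin (2 * y) = 2 * cos (x + y) * sin (x - y)" for x y :: real
    using sin_add[of "x + y" "x - y"] sin_diff[of "x + y" "x - y"] by simp
  have "sin (B - D) = sin ((A + B) - (A + D))" by simp
  then have e: "sin (A + B) * cos (A + D) - cos (A + B) * sin (A + D) = sin (B - D)"
    by (simp only: sin_diff)
  have "signed_area ((c + of_real r * cis (- b)) - (c + of_real r * cis (- a)))
      ((c + of_real r * cis (- d)) - (c + of_real r * cis (- a)))
    = r\<^sup>2 * ((cos (2*B) - cos (2*A)) * - (sin (2*D) - sin (2*A))
        + (sin (2*B) - sin (2*A)) * (cos (2*D) - cos (2*A)))"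
    by (simp add: signed_area_def abd algebra_simps power2_eq_square)
  also have "\<dots> = r\<^sup>2 * (4 * sin (B - A) * sin (D - A)
      * (sin (A + B) * cos (A + D) - cos (A + B) * sin (A + D)))"
    unfolding c s by (simp add: algebra_simps)
  also have "\<dots> = r\<^sup>2 * (4 * sin (B - A) * sin (D - A) * - sin (D - B))"
    unfolding e by (metis minus_diff_eq sin_minus)
  finally show ?thesis
    by (simp add: A_def B_def D_def diff_divide_distrib)
qed

lemma signed_area_rotate: "signed_area (b - a) (d - a) = signed_area (d - b) (a - b)"
  by (simp add: signed_area_def algebra_simps)

lemma signed_area_swap: "signed_area (b - a) (d - a) = - signed_area (d - a) (b - a)"
  by (simp add: signed_area_def algebra_simps)

locale circular_diagram =
  fixes N :: nat and v :: "nat \<Rightarrow> complex"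
  assumes on_circle: "clockwise_on_circle N v"
begin

lemma area_clockwise:
  assumes "x \<in> {1..N}" "y \<in> {1..N}" "z \<in> {1..N}" "clockwise x y z"
  shows "signed_area (v y - v x) (v z - v x) < 0"
proof -
  obtain c r \<theta> where r: "r > 0" and mono: "strict_mono_on {1..N} \<theta>" and w: "\<theta> N < \<theta> 1 + 2 * pi"
    and v: "\<And>j. j \<in> {1..N} \<Longrightarrow> v j = c + complex_of_real r * cis (- \<theta> j)"
    using on_circle by (auto simp: clockwise_on_circle_def)
  have lin: "signed_area (v b - v a) (v d - v a) < 0"
    if abd: "a \<in> {1..N}" "b \<in> {1..N}" "d \<in> {1..N}" "a < b" "b < d" for a b d
  proof -
    have ord: "\<theta> a < \<theta> b" "\<theta> b < \<theta> d"
      using abd mono by (auto simp: strict_mono_on_def)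
    have "\<theta> 1 \<le> \<theta> a" "\<theta> d \<le> \<theta> N"
      using abd strict_mono_on_leD[OF mono] by auto
    then have "\<theta> d - \<theta> a < 2 * pi" using w by linarith
    then have "sin ((\<theta> b - \<theta> a) / 2) > 0" "sin ((\<theta> d - \<theta> b) / 2) > 0" "sin ((\<theta> d - \<theta> a) / 2) > 0"
      using ord by (auto intro!: sin_gt_zero)
    then have "0 < 4 * r\<^sup>2 * (sin ((\<theta> b - \<theta> a) / 2) * sin ((\<theta> d - \<theta> b) / 2) * sin ((\<theta> d - \<theta> a) / 2))"
      using r by simp
    then show ?thesis
      unfolding v[OF abd(1)] v[OF abd(2)] v[OF abd(3)] inscribed_triangle_area by linarith
  qed
  from assms(4) consider "x < y" "y < z" | "y < z" "z < x" | "z < x" "x < y"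
    by (auto simp: clockwise_def)
  then show ?thesis
  proof cases
    case 1 then show ?thesis using lin assms by simp
  next
    case 2 then show ?thesis using lin[of y z x] assms by (simp add: signed_area_rotate[of "v y" "v x"])
  next
    case 3 then show ?thesis using lin[of z x y] assms by (simp add: signed_area_rotate[of "v x" "v z"])
  qed
qed

lemma area_anticlockwise:
  assumes "x \<in> {1..N}" "y \<in> {1..N}" "z \<in> {1..N}" "clockwise x z y"
  shows "signed_area (v y - v x) (v z - v x) > 0"
  using area_clockwise[OF assms(1,3,2,4)] signed_area_swap[of "v y" "v x" "v z"] by simp

text \<open>Two chords with four different endpoints meet exactly if the endpoints of one are separated by
  the other.\<close>
lemma chords_cross_iff:
  assumes in_range: "a \<in> {1..N}" "b \<in> {1..N}" "c \<in> {1..N}" "d \<in> {1..N}"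
    and distinct: "distinct [a, b, c, d]"
  shows "chords_cross v (a, b) (c, d) \<longleftrightarrow> (clockwise a c b \<noteq> clockwise a d b)"
proof -
  let ?s = "\<lambda>x y z. signed_area (v y - v x) (v z - v x)"
  have split: "clockwise x y z \<or> clockwise x z y" if "distinct [x, y, z]" for x y z :: nat
    using that by (auto simp: clockwise_def)
  have pos: "?s x y z > 0" if "clockwise x z y" "x \<in> {1..N}" "y \<in> {1..N}" "z \<in> {1..N}" for x y z
    using area_anticlockwise that by blast
  have neg: "?s x y z < 0" if "\<not> clockwise x z y" "distinct [x, y, z]" "x \<in> {1..N}" "y \<in> {1..N}" "z \<in> {1..N}" for x y z
    using area_clockwise that split by blast
  show ?thesis
  proof
    assume "chords_cross v (a, b) (c, d)"
    then obtain p where p: "p \<in> open_segment (v a) (v b)" "p \<in> open_segment (v c) (v d)"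
      by (auto simp: chords_cross_def)
    obtain t where t: "p = (1 - t) *\<^sub>R v a + t *\<^sub>R v b" using p(1) by (auto simp: in_segment)
    obtain u where u: "0 < u" "u < 1" "p = (1 - u) *\<^sub>R v c + u *\<^sub>R v d" using p(2) by (auto simp: in_segment)
    have "signed_area (v b - v a) (p - v a) = 0"
      unfolding t by (simp add: signed_area_def algebra_simps)
    moreover have "signed_area (v b - v a) (p - v a) = (1 - u) * ?s a b c + u * ?s a b d"
      unfolding u(3) by (simp add: signed_area_def algebra_simps)
    ultimately have z: "(1 - u) * ?s a b c + u * ?s a b d = 0" by simp
    show "clockwise a c b \<noteq> clockwise a d b"
    proof
      assume eq: "clockwise a c b = clockwise a d b"
      show False
      proof (cases "clockwise a c b")
        case True
        then have "?s a b c > 0" "?s a b d > 0" using eq pos in_range by auto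
        then have "(1 - u) * ?s a b c + u * ?s a b d > 0" using u by (intro add_pos_pos mult_pos_pos) auto
        then show False using z by simp
      next
        case False
        then have "?s a b c < 0" "?s a b d < 0" using eq neg in_range distinct by auto
        then have "(1 - u) * ?s a b c + u * ?s a b d < 0" using u by (intro add_neg_neg mult_pos_neg) auto
        then show False using z by simp
      qed
    qed
  next
    assume ne: "clockwise a c b \<noteq> clockwise a d b"
    then have ne': "clockwise c a d \<noteq> clockwise c b d"
      using distinct unfolding clockwise_def distinct.simps list.set insert_iff empty_iff
      by (smt (verit) linorder_less_linear order_less_trans order_less_asym)
    have dist: "distinct [a, b, c]" "distinct [a, b, d]" "distinct [c, d, a]" "distinct [c, d, b]"
      using distinct by auto
    let ?\<Delta> = "signed_area (v b - v a) (v d - v c)"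
    \<comment> \<open>The parameters of the intersection point of the two lines, by Cramer's rule.\<close>
    define t u where "t = ?s c d a / ?\<Delta>" and "u = - ?s a b c / ?\<Delta>"
    have d1: "?\<Delta> = ?s a b d - ?s a b c" and d2: "?\<Delta> = ?s c d a - ?s c d b"
      by (simp_all add: signed_area_def algebra_simps)
    have s1: "?s a b c > 0 \<and> ?s a b d < 0 \<or> ?s a b c < 0 \<and> ?s a b d > 0"
      using ne pos[of a c b] pos[of a d b] neg[of a c b] neg[of a d b] in_range dist by auto
    have s2: "?s c d a > 0 \<and> ?s c d b < 0 \<or> ?s c d a < 0 \<and> ?s c d b > 0"
      using ne' pos[of c a d] pos[of c b d] neg[of c a d] neg[of c b d] in_range dist by auto
    have "?\<Delta> \<noteq> 0" using d1 s1 by linarith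
    have t: "0 < t" "t < 1" unfolding t_def d2 using s2 by (auto simp: divide_simps)
    have u: "0 < u" "u < 1" unfolding u_def d1 using s1 by (auto simp: divide_simps)
    have "?\<Delta> *\<^sub>R ((1 - t) *\<^sub>R v a + t *\<^sub>R v b) = (?\<Delta> - ?s c d a) *\<^sub>R v a + ?s c d a *\<^sub>R v b"
      using \<open>?\<Delta> \<noteq> 0\<close> by (simp add: t_def scaleR_add_right scaleR_diff_left algebra_simps)
    also have "\<dots> = (?\<Delta> + ?s a b c) *\<^sub>R v c - ?s a b c *\<^sub>R v d"
      by (simp add: complex_eq_iff signed_area_def algebra_simps)
    also have "\<dots> = ?\<Delta> *\<^sub>R ((1 - u) *\<^sub>R v c + u *\<^sub>R v d)"
      using \<open>?\<Delta> \<noteq> 0\<close> by (simp add: u_def scaleR_add_right scaleR_diff_left algebra_simps)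
    finally have eq: "(1 - t) *\<^sub>R v a + t *\<^sub>R v b = (1 - u) *\<^sub>R v c + u *\<^sub>R v d"
      using \<open>?\<Delta> \<noteq> 0\<close> by simp
    have "v a \<noteq> v b" "v c \<noteq> v d" using \<open>?\<Delta> \<noteq> 0\<close> by (auto simp: signed_area_def)
    then have "(1 - t) *\<^sub>R v a + t *\<^sub>R v b \<in> open_segment (v a) (v b) \<inter> open_segment (v c) (v d)"
      using t u eq unfolding Int_iff in_segment by blast
    then show "chords_cross v (a, b) (c, d)"
      unfolding chords_cross_def by auto
  qed
qed

text \<open>The second chord starts to the left of the first one and ends to its right.\<close>
lemma crossing_oriented:
  assumes "a \<in> {1..N}" "b \<in> {1..N}" "c \<in> {1..N}" "d \<in> {1..N}"
    and "clockwise a c b" "clockwise a b d"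
  shows "signed_area (edge_direction v (a, b)) (edge_direction v (c, d)) < 0"
proof -
  have "signed_area (v b - v a) (v d - v c)
    = signed_area (v b - v a) (v d - v a) - signed_area (v b - v a) (v c - v a)"
    by (simp add: signed_area_def algebra_simps)
  then show ?thesis
    using area_anticlockwise[of a b c] area_clockwise[of a b d] assms by (simp add: edge_direction_def)
qed

lemma crossing_transversal:
  assumes "a \<in> {1..N}" "b \<in> {1..N}" "c \<in> {1..N}" "d \<in> {1..N}"
    and "distinct [a, b, c, d]" "chords_cross v (a, b) (c, d)"
  shows "signed_area (edge_direction v (a, b)) (edge_direction v (c, d)) \<noteq> 0"
proof -
  have "clockwise a c b \<and> clockwise a b d \<or> clockwise a d b \<and> clockwise a b c"
  proof -
    have "clockwise a b x \<longleftrightarrow> \<not> clockwise a x b" if "x \<in> {c, d}" for x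
      using that assms(5) by (intro clockwise_swap) auto
    then show ?thesis
      using assms(6) chords_cross_iff[OF assms(1-5)] by auto
  qed
  then show ?thesis
  proof
    assume "clockwise a c b \<and> clockwise a b d"
    then show ?thesis using crossing_oriented[OF assms(1-4)] by fastforce
  next
    assume "clockwise a d b \<and> clockwise a b c"
    moreover have "signed_area (edge_direction v (a, b)) (edge_direction v (c, d))
      = - signed_area (edge_direction v (a, b)) (edge_direction v (d, c))"
      by (simp add: signed_area_def edge_direction_def algebra_simps)
    ultimately show ?thesis using crossing_oriented[OF assms(1,2,4,3)] by simp
  qed
qed

end

section \<open>Edges of monotonic cycles\<close>

text \<open>The pairs of cyclically consecutive elements of \<open>S\<close>. This describes the edges of an increasing
  cycle by its vertex set alone, without reference to a starting vertex.\<close>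
definition gaps :: "nat set \<Rightarrow> (nat \<times> nat) set" where
  "gaps S = {(x, y). x \<in> S \<and> y \<in> S \<and> x \<noteq> y \<and> (\<forall>z\<in>S. \<not> clockwise x z y)}"

lemma gaps_right_unique: "(x, y) \<in> gaps S \<Longrightarrow> (x, z) \<in> gaps S \<Longrightarrow> y = z"
  using clockwise_swap[of x y z] by (auto simp: gaps_def)

text \<open>Only on a set of two elements can a gap be followed by its own reversal.\<close>
lemma gaps_asym:
  assumes "3 \<le> card S" "(x, y) \<in> gaps S"
  shows "(y, x) \<notin> gaps S"
proof
  assume *: "(y, x) \<in> gaps S"
  have "\<not> S \<subseteq> {x, y}"
  proof
    assume "S \<subseteq> {x, y}"
    then have "card S \<le> card {x, y}" by (intro card_mono) auto
    also have "\<dots> \<le> 2" by (simp add: card_insert_if)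
    finally show False using assms(1) by simp
  qed
  then obtain z where "z \<in> S" "z \<noteq> x" "z \<noteq> y" by blast
  then show False
    using assms(2) * clockwise_swap[of x y z] clockwise_rotate[of x y z] by (auto simp: gaps_def)
qed

text \<open>Two neighbours in a sorted list have nothing between them; neither have the last and the first
  entry in the cyclic order, as they are the maximum and the minimum.\<close>
lemma oriented_edges_sorted:
  assumes sorted: "sorted_wrt (<) c" and len: "2 \<le> length c"
  shows "oriented_edges c = gaps (set c)"
proof -
  let ?L = "length c"
  have less: "c ! j < c ! k" if "j < k" "k < ?L" for j k
    using sorted_wrt_nth_less[OF sorted] that by blast
  have mono: "j < k \<longleftrightarrow> c ! j < c ! k" if "j < ?L" "k < ?L" for j k
    using less[of j k] less[of k j] that by (metis less_asym linorder_less_linear)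
  have sub: "(c ! j, c ! (Suc j mod ?L)) \<in> gaps (set c)" if j: "j < ?L" for j
  proof (cases "Suc j < ?L")
    case True
    have "\<not> clockwise (c ! j) (c ! k) (c ! Suc j)" if "k < ?L" for k
      using mono[of j k] mono[of k "Suc j"] less[of j "Suc j"] that j True
      by (auto simp: clockwise_def)
    then have "\<forall>z\<in>set c. \<not> clockwise (c ! j) z (c ! Suc j)" by (auto simp: in_set_conv_nth)
    then show ?thesis using True j less[of j "Suc j"] by (simp add: gaps_def)
  next
    case False
    then have e: "Suc j = ?L" using j by simp
    have "\<not> clockwise (c ! j) (c ! k) (c ! 0)" if "k < ?L" for k
    proof -
      have "c \<noteq> []" using len by (cases c) auto
      then show ?thesis
        using mono[of j k] mono[of k 0] less[of 0 j] that j e len by (auto simp: clockwise_def)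
    qed
    then have "\<forall>z\<in>set c. \<not> clockwise (c ! j) z (c ! 0)" by (auto simp: in_set_conv_nth)
    moreover have "c ! 0 < c ! j" using less[of 0 j] len e by simp
    moreover have "c ! 0 \<in> set c" using len by (cases c) auto
    ultimately show ?thesis using e j by (simp add: gaps_def)
  qed
  show ?thesis
  proof (intro equalityI subsetI)
    fix p assume "p \<in> oriented_edges c"
    then show "p \<in> gaps (set c)" using sub by (auto simp: oriented_edges_def)
  next
    fix p assume p: "p \<in> gaps (set c)"
    obtain x y where xy: "p = (x, y)" by (cases p)
    with p have "x \<in> set c" by (simp add: gaps_def)
    then obtain j where j: "j < ?L" "x = c ! j" by (auto simp: in_set_conv_nth)
    then have "y = c ! (Suc j mod ?L)" using p xy sub gaps_right_unique by blast
    then show "p \<in> oriented_edges c" using j xy by (auto simp: oriented_edges_def)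
  qed
qed

lemma oriented_edges_rotate: "oriented_edges (rotate s c) = oriented_edges c"
proof -
  have sub: "oriented_edges (rotate s c) \<subseteq> oriented_edges c" for s and c :: "nat list"
  proof
    fix p assume "p \<in> oriented_edges (rotate s c)"
    then obtain j where j: "j < length c"
      and p: "p = (rotate s c ! j, rotate s c ! (Suc j mod length c))"
      by (auto simp: oriented_edges_def)
    then have 0: "0 < length c" by linarith
    have "p = (c ! ((s + j) mod length c), c ! (Suc ((s + j) mod length c) mod length c))"
      using j 0 by (simp add: p nth_rotate mod_simps)
    then show "p \<in> oriented_edges c"
      using 0 by (auto simp: oriented_edges_def)
  qed
  \<comment> \<open>A rotation by a multiple of the length is trivial, so rotations are invertible.\<close>
  have "rotate (length c * s - s) (rotate s c) = c"
  proof (cases "c = []")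
    case False
    then have "length c * s - s + s = length c * s" by (simp add: Suc_leI)
    then show ?thesis by (simp add: rotate_rotate)
  qed simp
  then show ?thesis using sub[of s c] sub[of "length c * s - s" "rotate s c"] by auto
qed

lemma oriented_edges_rev: "oriented_edges (rev c) = prod.swap ` oriented_edges c"
proof -
  have sub: "prod.swap ` oriented_edges (rev c) \<subseteq> oriented_edges c" for c :: "nat list"
  proof
    fix p assume "p \<in> prod.swap ` oriented_edges (rev c)"
    then obtain j where j: "j < length c"
      and p: "p = (rev c ! (Suc j mod length c), rev c ! j)"
      by (auto simp: oriented_edges_def)
    let ?L = "length c"
    define k where "k = ?L - Suc (Suc j mod ?L)"
    have "Suc j mod ?L < ?L" using j by (intro mod_less_divisor) linarith
    then have k: "k < ?L" "rev c ! (Suc j mod ?L) = c ! k"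
      by (auto simp: k_def rev_nth)
    have "Suc k mod ?L = ?L - Suc j"
    proof (cases "Suc j = ?L")
      case True
      then have "Suc k = ?L" by (simp add: k_def)
      then show ?thesis using True by simp
    next
      case False
      then have "Suc j < ?L" using j by simp
      then show ?thesis by (simp add: k_def Suc_diff_Suc)
    qed
    then have "p = (c ! k, c ! (Suc k mod ?L))" using j k by (simp add: p rev_nth)
    then show "p \<in> oriented_edges c" using k(1) by (auto simp: oriented_edges_def)
  qed
  have "prod.swap ` prod.swap ` X = X" for X :: "(nat \<times> nat) set" by (simp add: image_comp)
  then show ?thesis using sub[of c] sub[of "rev c"] by (metis image_mono rev_rev_ident subset_antisym)
qed

lemma monotonic_cycle_edges:
  assumes "is_cycle N c" "monotonic_cycle c"
  shows "oriented_edges c = gaps (set c) \<or> oriented_edges c = prod.swap ` gaps (set c)"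
proof -
  have len: "2 \<le> length c" using assms(1) by (simp add: is_cycle_def)
  from assms(2) consider s where "successively (<) (rotate s c)" | s where "successively (>) (rotate s c)"
    by (auto simp: monotonic_cycle_def strictly_increasing_cycle_def strictly_decreasing_cycle_def)
  then show ?thesis
  proof cases
    case 1
    then have "sorted_wrt (<) (rotate s c)" by (simp add: successively_conv_sorted_wrt transp_on_def)
    then show ?thesis using oriented_edges_sorted[of "rotate s c"] len
      by (simp add: oriented_edges_rotate)
  next
    case 2
    then have "sorted_wrt (>) (rotate s c)" by (simp add: successively_conv_sorted_wrt transp_on_def)
    then have "sorted_wrt (<) (rev (rotate s c))" by (simp add: sorted_wrt_rev)
    then have "prod.swap ` oriented_edges c = gaps (set c)"
      using oriented_edges_sorted[of "rev (rotate s c)"] len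
      by (simp add: oriented_edges_rotate oriented_edges_rev)
    then have "prod.swap ` prod.swap ` oriented_edges c = prod.swap ` gaps (set c)" by simp
    then show ?thesis by (simp add: image_comp)
  qed
qed

lemma clockwise_succ_right:
  assumes "x \<in> {1..N}" "y \<in> {1..N}" "z \<in> {1..N}" "x \<noteq> y"
  shows "clockwise x z (cyclic_succ N y) \<longleftrightarrow>
    x \<noteq> cyclic_succ N y \<and> x \<noteq> z \<and> (clockwise x z y \<or> z = y)"
  using assms by (cases "y = N") (auto simp: clockwise_def cyclic_succ_less)

lemma clockwise_succ_mid:
  assumes "x \<in> {1..N}" "y \<in> {1..N}" "z \<in> {1..N}" "clockwise x z y"
  shows "cyclic_succ N z = y \<or> clockwise x (cyclic_succ N z) y"
  using assms by (cases "z = N") (auto simp: clockwise_def cyclic_succ_less)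

lemma clockwise_succ_first:
  assumes "x \<in> {1..N}" "y \<in> {1..N}" "x \<noteq> y"
  shows "cyclic_succ N x = y \<or> clockwise x (cyclic_succ N x) y"
  using assms by (cases "x = N") (auto simp: clockwise_def cyclic_succ_less)

lemma not_clockwise_succ:
  assumes "x \<in> {1..N}" "z \<in> {1..N}"
  shows "\<not> clockwise x z (cyclic_succ N x)"
  using assms by (cases "x = N") (auto simp: clockwise_def cyclic_succ_less)

lemma cyclic_succ_eq_iff:
  "x \<in> {1..N} \<Longrightarrow> y \<in> {1..N} \<Longrightarrow> cyclic_succ N x = cyclic_succ N y \<longleftrightarrow> x = y"
  using inj_on_cyclic_succ by (rule inj_on_eq_iff)

lemma interior_edge_iff:
  assumes "x \<in> {1..N}" "y \<in> {1..N}"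
  shows "unoriented (x, y) \<in> interior_edges N \<longleftrightarrow>
    x \<noteq> y \<and> y \<noteq> cyclic_succ N x \<and> x \<noteq> cyclic_succ N y"
proof -
  have "{x, y} \<in> complete_edges N \<longleftrightarrow> x \<noteq> y"
    using assms by (auto simp: complete_edges_def doubleton_eq_iff)
  moreover have "{x, y} \<in> exterior_edges N \<longleftrightarrow> y = cyclic_succ N x \<or> x = cyclic_succ N y"
    using assms by (auto simp: exterior_edges_def cyclic_succ_def doubleton_eq_iff simp del: One_nat_def)
  ultimately show ?thesis by (simp add: unoriented_def interior_edges_def)
qed

text \<open>The set \<open>A\<close> and its complement are the two colours of the vertices.\<close>
definition colour_changes :: "nat \<Rightarrow> nat set \<Rightarrow> nat set" where
  "colour_changes N A = {x \<in> {1..N}. (x \<in> A) \<noteq> (cyclic_succ N x \<in> A)}"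

lemma colour_changes_complement: "colour_changes N ({1..N} - A) = colour_changes N A"
  unfolding colour_changes_def using cyclic_succ_in by blast

locale two_colouring =
  fixes N :: nat and A :: "nat set"
  assumes A_sub: "A \<subseteq> {1..N}" and card_A: "3 \<le> card A"
begin

abbreviation "s \<equiv> cyclic_succ N"
abbreviation "D \<equiv> colour_changes N A"

text \<open>Walking clockwise from \<open>s x\<close>, the colour cannot change before the next colour change \<open>y\<close> has been
  passed. If the walk passes the vertex \<open>N\<close>, it is split there.\<close>
lemma colour_constant_between_changes:
  assumes gap: "(x, y) \<in> gaps D" and w: "w \<in> {1..N}" "clockwise x w y \<or> w = y"
  shows "w \<in> A \<longleftrightarrow> s x \<in> A"
proof -
  have xy: "x \<in> {1..N}" "y \<in> {1..N}" "x \<noteq> y"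
    using gap by (auto simp: gaps_def colour_changes_def)
  have same: "s u \<in> A \<longleftrightarrow> u \<in> A" if "u \<in> {1..N}" "clockwise x u y" for u
    using gap that by (auto simp: gaps_def colour_changes_def)
  have up: "w \<in> A \<longleftrightarrow> Suc x \<in> A" if "Suc x \<le> w" "x < y \<Longrightarrow> w \<le> y" "w \<le> N" for w
    using that
  proof (induction rule: dec_induct)
    case (step u)
    then have "clockwise x u y" "u \<in> {1..N}" "u < N"
      using xy by (auto simp: clockwise_def)
    moreover have "u \<in> A \<longleftrightarrow> Suc x \<in> A" using step.prems by (intro step.IH) auto
    ultimately show ?case using same[of u] by (simp add: cyclic_succ_less)
  qed simp
  show ?thesis
  proof (cases "x < w")
    case True
    then have "s x = Suc x" using xy w by (simp add: cyclic_succ_less)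
    moreover have "x < y \<Longrightarrow> w \<le> y" using w(2) by (auto simp: clockwise_def)
    ultimately show ?thesis using up[of w] True w(1) by simp
  next
    case False
    then have y: "w \<le> y" "y < x" using w(2) xy by (auto simp: clockwise_def)
    have one: "1 \<in> A \<longleftrightarrow> s x \<in> A"
    proof (cases "x = N")
      case False
      then have "clockwise x N y" using y xy by (auto simp: clockwise_def)
      then show ?thesis using same[of N] up[of N] False xy y by (simp add: cyclic_succ_less)
    qed simp
    have "1 \<le> w" using w by simp
    then have "w \<in> A \<longleftrightarrow> 1 \<in> A" using y(1)
    proof (induction rule: dec_induct)
      case (step u)
      then have "clockwise x u y" "u \<in> {1..N}" "u < N"
        using xy y by (auto simp: clockwise_def)
      then show ?case using same[of u] step by (simp add: cyclic_succ_less)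
    qed simp
    then show ?thesis using one by simp
  qed
qed

lemma colours_at_gap:
  assumes gap: "(x, y) \<in> gaps D" and x: "x \<in> A"
  shows "x \<in> {1..N}" "y \<in> {1..N}" "s y \<in> {1..N}" "x \<noteq> y" "s x \<notin> A" "y \<notin> A" "s y \<in> A" "x \<noteq> s y"
proof -
  show xy: "x \<in> {1..N}" "y \<in> {1..N}" "x \<noteq> y"
    using gap by (auto simp: gaps_def colour_changes_def)
  show "s y \<in> {1..N}" using xy cyclic_succ_in by blast
  show sx: "s x \<notin> A" using gap x by (auto simp: gaps_def colour_changes_def)
  show y: "y \<notin> A" using colour_constant_between_changes[OF gap xy(2)] sx by simp
  show "s y \<in> A" using gap y by (auto simp: gaps_def colour_changes_def)
  show "x \<noteq> s y"
  proof
    assume e: "x = s y"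
    have "w \<notin> A" if w: "w \<in> {1..N}" "w \<noteq> x" for w
    proof -
      have "clockwise x w y \<or> w = y"
        using not_clockwise_succ[of y N w] w xy e clockwise_swap[of x y w] clockwise_rotate[of x y w]
        by metis
      then show ?thesis using colour_constant_between_changes[OF gap w(1)] sx by simp
    qed
    then have "A \<subseteq> {x}" using A_sub by blast
    then have "card A \<le> card {x}" by (intro card_mono) auto
    then show False using card_A by simp
  qed
qed

text \<open>The block of the other colour that begins after \<open>x\<close> ends at \<open>y\<close>. So \<open>s y\<close> is the next vertex of
  the colour of \<open>x\<close>, and the edge to it jumps over a nonempty block. It is not the exterior edge
  from \<open>s y\<close> to \<open>x\<close> either, because there are at least three vertices of this colour.\<close>
lemma gap_edge:
  assumes gap: "(x, y) \<in> gaps D" and x: "x \<in> A"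
  shows "(x, s y) \<in> gaps A" "unoriented (x, s y) \<in> interior_edges N"
proof -
  note c = colours_at_gap[OF assms]
  have "\<not> clockwise x z (s y)" if z: "z \<in> A" for z
  proof
    assume "clockwise x z (s y)"
    moreover have zN: "z \<in> {1..N}" using z A_sub by blast
    ultimately have "clockwise x z y \<or> z = y"
      using clockwise_succ_right[OF c(1,2) zN c(4)] by blast
    then show False using colour_constant_between_changes[OF gap zN] c(5) z by blast
  qed
  then show g: "(x, s y) \<in> gaps A" using x c by (simp add: gaps_def)
  have "s y \<noteq> s x" using c cyclic_succ_eq_iff by blast
  moreover have "x \<noteq> s (s y)"
  proof
    assume e: "x = s (s y)"
    then have "(s y, x) \<in> gaps A"
      using not_clockwise_succ[OF c(3)] A_sub x c by (auto simp: gaps_def)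
    then show False using gaps_asym[OF card_A g] by blast
  qed
  ultimately show "unoriented (x, s y) \<in> interior_edges N"
    using interior_edge_iff[OF c(1,3)] c(8) by blast
qed

text \<open>The vertex \<open>y\<close> is the predecessor of \<open>z\<close> on the circle: an interior edge jumps over a block of the
  other colour, and \<open>y\<close> is the last vertex of this block.\<close>
lemma gap_edge_surj:
  assumes g: "(x, z) \<in> gaps A" and int: "unoriented (x, z) \<in> interior_edges N"
  shows "\<exists>y. (x, y) \<in> gaps D \<and> z = s y"
proof -
  have xz: "x \<in> A" "z \<in> A" "x \<noteq> z" and nob: "\<And>w. w \<in> A \<Longrightarrow> \<not> clockwise x w z"
    using g by (auto simp: gaps_def)
  have r: "x \<in> {1..N}" "z \<in> {1..N}" using xz A_sub by auto
  have sx: "s x \<notin> A"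
    using clockwise_succ_first[OF r xz(3)] nob interior_edge_iff[OF r] int by blast
  then have xD: "x \<in> D" using xz r by (simp add: colour_changes_def)
  have "z \<in> s ` {1..N}" using bij_betw_cyclic_succ[of N] r by (simp add: bij_betw_def)
  then obtain y where y: "y \<in> {1..N}" "z = s y" by blast
  have ne: "x \<noteq> y" using y sx xz by auto
  have bet: "clockwise x w y \<or> w = y \<Longrightarrow> clockwise x w z" if "w \<in> {1..N}" for w
    using clockwise_succ_right[OF r(1) y(1) that ne] y xz ne clockwise_distinct[of x w y] by blast
  have yA: "y \<notin> A" using bet[OF y(1)] nob by blast
  then have yD: "y \<in> D" using y xz by (simp add: colour_changes_def)
  have "\<not> clockwise x w y" if "w \<in> D" for w
  proof
    assume cw: "clockwise x w y"
    have w: "w \<in> {1..N}" using that by (simp add: colour_changes_def)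
    have "w \<notin> A" using bet[OF w] nob cw by blast
    moreover have "s w \<notin> A"
      using clockwise_succ_mid[OF r(1) y(1) w cw] bet[of "s w"] cyclic_succ_in[OF w] nob yA by blast
    ultimately show False using that by (simp add: colour_changes_def)
  qed
  then show ?thesis using xD yD ne y by (auto simp: gaps_def)
qed

lemma interior_gaps:
  "{d \<in> gaps A. unoriented d \<in> interior_edges N} = {(x, s y) | x y. (x, y) \<in> gaps D \<and> x \<in> A}"
proof (intro equalityI subsetI)
  fix d assume d: "d \<in> {d \<in> gaps A. unoriented d \<in> interior_edges N}"
  obtain x z where "d = (x, z)" by (cases d)
  with d show "d \<in> {(x, s y) | x y. (x, y) \<in> gaps D \<and> x \<in> A}"
    using gap_edge_surj[of x z] by (auto simp: gaps_def)
qed (use gap_edge in auto)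

end

section \<open>Crossings between two complementary monotonic cycles\<close>

context two_colouring
begin

text \<open>The other colour has only one block between \<open>x\<close> and \<open>s y\<close>, so the only chord of the other colour
  that lands there is the one that lands on the first vertex of this block.\<close>
lemma succ_change_between:
  assumes gap: "(x, y) \<in> gaps D" and x: "x \<in> A" and t: "t \<in> D" "t \<in> A"
  shows "clockwise x (s t) (s y) \<longleftrightarrow> t = x"
proof -
  note c = colours_at_gap[OF gap x]
  have tN: "t \<in> {1..N}" "s t \<notin> A" using t by (auto simp: colour_changes_def)
  then have st: "s t \<in> {1..N}" using cyclic_succ_in by blast
  have iff: "clockwise x (s t) (s y) \<longleftrightarrow> clockwise x (s t) y \<or> s t = y"
    using clockwise_succ_right[OF c(1,2) st c(4)] c(8) x tN by metis
  show ?thesis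
  proof
    assume "t = x"
    then show "clockwise x (s t) (s y)"
      using iff clockwise_succ_first[OF c(1,2,4)] by blast
  next
    assume *: "clockwise x (s t) (s y)"
    show "t = x"
    proof (rule ccontr)
      assume "t \<noteq> x"
      have "y \<noteq> t" using c t by blast
      have "\<not> clockwise x t y" using gap t by (auto simp: gaps_def)
      then have "clockwise x y t"
        using clockwise_swap[of x y t] c(4) \<open>t \<noteq> x\<close> \<open>y \<noteq> t\<close> by blast
      then have "clockwise x y (s t)"
        using clockwise_succ_right[OF c(1) tN(1) c(2)] \<open>t \<noteq> x\<close> c(4) x tN by metis
      moreover have "clockwise x (s t) y \<or> s t = y" using * iff by blast
      ultimately show False using clockwise_swap[of x y "s t"] clockwise_distinct by metis
    qed
  qed
qed

text \<open>Likewise, the only chord of the other colour that starts between \<open>x\<close> and \<open>s y\<close> starts at the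
  last vertex of the block.\<close>
lemma change_between:
  assumes gap: "(x, y) \<in> gaps D" and x: "x \<in> A" and u: "u \<in> D" "u \<notin> A"
  shows "clockwise x u (s y) \<longleftrightarrow> u = y"
proof -
  note c = colours_at_gap[OF gap x]
  have "u \<in> {1..N}" "x \<noteq> u" using u x by (auto simp: colour_changes_def)
  then show ?thesis
    using clockwise_succ_right[OF c(1,2) _ c(4)] c(8) gap u by (auto simp: gaps_def)
qed

lemma gap_end_colours:
  assumes gap: "(u, t) \<in> gaps D" and u: "u \<notin> A"
  shows "t \<in> D" "t \<in> A" "s t \<in> {1..N}" "s t \<notin> A"
proof -
  show t: "t \<in> D" using gap by (simp add: gaps_def)
  have "s u \<in> A" using gap u by (auto simp: gaps_def colour_changes_def)
  then show tA: "t \<in> A"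
    using colour_constant_between_changes[OF gap, of t] t by (simp add: colour_changes_def)
  show "s t \<in> {1..N}" "s t \<notin> A" using t tA cyclic_succ_in[of t N] by (auto simp: colour_changes_def)
qed

text \<open>The endpoints of two consecutive chords interlace clockwise. Without \<open>t \<noteq> x\<close> the whole circle
  would have just two colour changes, and the second chord would land inside the first one.\<close>
lemma consecutive_gaps_clockwise:
  assumes gap: "(x, y) \<in> gaps D" and x: "x \<in> A" and next_gap: "(y, t) \<in> gaps D" and ne: "t \<noteq> x"
  shows "clockwise x y (s y)" "clockwise x (s y) (s t)"
proof -
  note c = colours_at_gap[OF gap x] and e = gap_end_colours[OF next_gap c(6)]
  have "y \<in> D" using gap by (simp add: gaps_def)
  then show "clockwise x y (s y)" using change_between[OF gap x _ c(6)] by blast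
  have "\<not> clockwise x (s t) (s y)" using succ_change_between[OF gap x e(1,2)] ne by blast
  moreover have "x \<noteq> s t" "s y \<noteq> s t" using x c(7) e(4) by auto
  ultimately show "clockwise x (s y) (s t)"
    using clockwise_swap[of x "s t" "s y"] c(8) by metis
qed

end

text \<open>Twice the linking number, for arbitrary sets of oriented chords. Stated for sets of chords,
  the effect of reversing a cycle becomes visible.\<close>
definition crossing_sum ::
  "(nat \<Rightarrow> complex) \<Rightarrow> (nat set \<Rightarrow> nat set \<Rightarrow> bool) \<Rightarrow> (nat \<times> nat) set \<Rightarrow> (nat \<times> nat) set \<Rightarrow> int" where
  "crossing_sum v h X Y = (\<Sum>(d, f)\<in>{(d, f). d \<in> X \<and> f \<in> Y \<and> chords_cross v d f}. crossing_sign v h d f)"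

lemma over_under_sign_eq:
  "signed_area (edge_direction v d) (edge_direction v f) < 0 \<Longrightarrow> over_under_sign v d f = -1"
  "signed_area (edge_direction v d) (edge_direction v f) > 0 \<Longrightarrow> over_under_sign v d f = 1"
  by (simp_all add: over_under_sign_def positively_oriented_iff)

lemma signed_area_minus:
  "signed_area (- x) y = - signed_area x y" "signed_area x (- y) = - signed_area x y"
  by (simp_all add: signed_area_def)

lemma signed_area_commute: "signed_area y x = - signed_area x y"
  by (simp add: signed_area_def)

lemma edge_direction_swap: "edge_direction v (prod.swap d) = - edge_direction v d"
  by (simp add: edge_direction_def)

lemma unoriented_swap: "unoriented (prod.swap d) = unoriented d"
  by (auto simp: unoriented_def)

lemma chords_cross_swap:
  "chords_cross v (prod.swap d) f = chords_cross v d f"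
  "chords_cross v d (prod.swap f) = chords_cross v d f"
  by (simp_all add: chords_cross_def open_segment_commute)

lemma crossing_sign_swap:
  assumes "signed_area (edge_direction v d) (edge_direction v f) \<noteq> 0"
  shows "crossing_sign v h (prod.swap d) f = - crossing_sign v h d f"
    "crossing_sign v h d (prod.swap f) = - crossing_sign v h d f"
  using assms signed_area_commute[of "edge_direction v d" "edge_direction v f"]
  by (auto simp: crossing_sign_def unoriented_swap over_under_sign_def positively_oriented_iff
      edge_direction_swap signed_area_minus)

text \<open>Reversing one of two transversal chords changes the orientation of both possible bases
  (over-edge, under-edge), whichever chord is higher.\<close>
lemma crossing_sum_swap:
  assumes "\<And>d f. d \<in> X \<Longrightarrow> f \<in> Y \<Longrightarrow> chords_cross v d f \<Longrightarrow>
    signed_area (edge_direction v d) (edge_direction v f) \<noteq> 0"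
  shows "crossing_sum v h (prod.swap ` X) Y = - crossing_sum v h X Y"
    and "crossing_sum v h X (prod.swap ` Y) = - crossing_sum v h X Y"
proof -
  let ?C = "{(d, f). d \<in> X \<and> f \<in> Y \<and> chords_cross v d f}"
  have "{(d, f). d \<in> prod.swap ` X \<and> f \<in> Y \<and> chords_cross v d f} = map_prod prod.swap id ` ?C"
    by (auto simp: image_iff chords_cross_swap[of v "(x, y)" for x y, simplified]
        chords_cross_swap[of v _ "(x, y)" for x y, simplified])
  moreover have "inj_on (map_prod prod.swap id) ?C" by (auto simp: inj_on_def)
  ultimately show "crossing_sum v h (prod.swap ` X) Y = - crossing_sum v h X Y"
    unfolding crossing_sum_def
    by (simp add: sum.reindex sum_negf[symmetric])
       (intro sum.cong refl, use assms crossing_sign_swap in auto)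
  have "{(d, f). d \<in> X \<and> f \<in> prod.swap ` Y \<and> chords_cross v d f} = map_prod id prod.swap ` ?C"
    by (auto simp: image_iff chords_cross_swap[of v "(x, y)" for x y, simplified]
        chords_cross_swap[of v _ "(x, y)" for x y, simplified])
  moreover have "inj_on (map_prod id prod.swap) ?C" by (auto simp: inj_on_def)
  ultimately show "crossing_sum v h X (prod.swap ` Y) = - crossing_sum v h X Y"
    unfolding crossing_sum_def
    by (simp add: sum.reindex sum_negf[symmetric])
       (intro sum.cong refl, use assms crossing_sign_swap in auto)
qed

lemma gaps_enumeration:
  assumes "2 \<le> card S"
  obtains d where "bij_betw d {1..card S} S"
    and "gaps S = (\<lambda>j. (d j, d (cyclic_succ (card S) j))) ` {1..card S}"
proof -
  have fin: "finite S" using assms(1) by (metis card.infinite not_numeral_le_zero)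
  define c where "c = sorted_list_of_set S"
  have c: "set c = S" "length c = card S" "sorted_wrt (<) c" "distinct c"
    using fin by (simp_all add: c_def)
  define d where "d j = c ! (j - 1)" for j
  let ?R = "card S"
  have "bij_betw ((!) c) {..<?R} S" using c by (metis bij_betw_nth)
  moreover have "bij_betw (\<lambda>j. j - 1) {1..?R} {..<?R}"
    by (rule bij_betw_byWitness[where f' = Suc]) auto
  ultimately have "bij_betw ((!) c \<circ> (\<lambda>j. j - 1)) {1..?R} S" using bij_betw_trans by blast
  then have bij: "bij_betw d {1..?R} S" by (simp add: d_def[abs_def] o_def)
  have "gaps S = oriented_edges c" using oriented_edges_sorted[of c] c assms by simp
  also have "\<dots> = (\<lambda>j. (c ! j, c ! (Suc j mod ?R))) ` {..<?R}"
    using c by (auto simp: oriented_edges_def)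
  also have "{..<?R} = (\<lambda>j. j - 1) ` {1..?R}"
    using \<open>bij_betw (\<lambda>j. j - 1) {1..?R} {..<?R}\<close> by (simp add: bij_betw_def)
  also have "(\<lambda>j. (c ! j, c ! (Suc j mod ?R))) ` (\<lambda>j. j - 1) ` {1..?R}
      = (\<lambda>j. (d j, d (cyclic_succ ?R j))) ` {1..?R}"
    unfolding image_image by (intro image_cong refl) (auto simp: d_def cyclic_succ_def)
  finally show ?thesis using bij that by blast
qed

text \<open>A circular diagram with two colours of at least three vertices each, together with an
  enumeration of the colour changes in clockwise order.\<close>
locale enumerated_diagram = circular_diagram N v + two_colouring N A
  for N :: nat and v :: "nat \<Rightarrow> complex" and A :: "nat set" +
  fixes d :: "nat \<Rightarrow> nat" and R :: nat
  assumes card_B: "3 \<le> card ({1..N} - A)"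
    and d_bij: "bij_betw d {1..R} (colour_changes N A)"
    and gaps_D: "gaps (colour_changes N A) = (\<lambda>j. (d j, d (cyclic_succ R j))) ` {1..R}"
begin

sublocale complement: two_colouring N "{1..N} - A"
  rewrites "colour_changes N ({1..N} - A) = colour_changes N A"
proof -
  show "two_colouring N ({1..N} - A)" by unfold_locales (use card_B in auto)
qed (rule colour_changes_complement)

abbreviation "B \<equiv> {1..N} - A"
abbreviation "nx \<equiv> cyclic_succ R"

text \<open>The interior edge that starts at the \<open>j\<close>-th colour change.\<close>
definition chord :: "nat \<Rightarrow> nat \<times> nat" where "chord j = (d j, s (d (nx j)))"
definition "A_indices = {j \<in> {1..R}. d j \<in> A}"
definition "B_indices = {j \<in> {1..R}. d j \<in> B}"

lemma d_gap: "j \<in> {1..R} \<Longrightarrow> (d j, d (nx j)) \<in> gaps D"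
  using gaps_D by auto

lemma d_in: "j \<in> {1..R} \<Longrightarrow> d j \<in> D"
  using d_bij by (auto simp: bij_betw_def)

lemma d_range: "j \<in> {1..R} \<Longrightarrow> d j \<in> {1..N}"
  using d_in by (simp add: colour_changes_def)

lemma d_eq_iff: "j \<in> {1..R} \<Longrightarrow> k \<in> {1..R} \<Longrightarrow> d j = d k \<longleftrightarrow> j = k"
  using d_bij by (metis bij_betw_def inj_on_eq_iff)

lemma indices_partition:
  "{1..R} = A_indices \<union> B_indices" "A_indices \<inter> B_indices = {}"
  "finite A_indices" "finite B_indices"
  using d_range by (auto simp: A_indices_def B_indices_def)

lemma nx_A_indices: "j \<in> A_indices \<Longrightarrow> nx j \<in> B_indices"
  using colours_at_gap[OF d_gap] cyclic_succ_in[of j R] by (auto simp: A_indices_def B_indices_def)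

lemma nx_B_indices: "j \<in> B_indices \<Longrightarrow> nx j \<in> A_indices"
  using complement.colours_at_gap[OF d_gap] cyclic_succ_in[of j R] by (auto simp: A_indices_def B_indices_def)

lemma interior_gaps_A: "{x \<in> gaps A. unoriented x \<in> interior_edges N} = chord ` A_indices"
proof -
  have "{(x, s y) | x y. (x, y) \<in> gaps D \<and> x \<in> A}
    = (\<lambda>(x, y). (x, s y)) ` {p \<in> gaps D. fst p \<in> A}"
    by (auto simp: image_iff)
  also have "{p \<in> gaps D. fst p \<in> A} = (\<lambda>j. (d j, d (nx j))) ` A_indices"
    unfolding gaps_D by (auto simp: A_indices_def)
  finally show ?thesis unfolding interior_gaps by (simp add: image_image chord_def)
qed

lemma interior_gaps_B: "{x \<in> gaps B. unoriented x \<in> interior_edges N} = chord ` B_indices"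
proof -
  have "{(x, s y) | x y. (x, y) \<in> gaps D \<and> x \<in> B}
    = (\<lambda>(x, y). (x, s y)) ` {p \<in> gaps D. fst p \<in> B}"
    by (auto simp: image_iff)
  also have "{p \<in> gaps D. fst p \<in> B} = (\<lambda>j. (d j, d (nx j))) ` B_indices"
    unfolding gaps_D by (auto simp: B_indices_def)
  finally show ?thesis unfolding complement.interior_gaps by (simp add: image_image chord_def)
qed

lemma chord_gap: "j \<in> A_indices \<Longrightarrow> chord j \<in> gaps A" "j \<in> B_indices \<Longrightarrow> chord j \<in> gaps B"
  using interior_gaps_A interior_gaps_B by blast+

lemma chord_interior: "j \<in> {1..R} \<Longrightarrow> unoriented (chord j) \<in> interior_edges N"
  using interior_gaps_A interior_gaps_B indices_partition(1) by blast

text \<open>Chords of different colours have different endpoints, and two chords of the same colour cannot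
  be reversals of each other by \<open>gaps_asym\<close>. So different indices yield different sheets of the book.\<close>
lemma inj_unoriented_chord: "inj_on (\<lambda>j. unoriented (chord j)) {1..R}"
proof (rule inj_onI)
  fix j k assume jk: "j \<in> {1..R}" "k \<in> {1..R}" "unoriented (chord j) = unoriented (chord k)"
  have sub: "unoriented (chord i) \<subseteq> A" if "i \<in> A_indices" for i
    using chord_gap(1)[OF that] by (auto simp: gaps_def unoriented_def)
  have sub': "unoriented (chord i) \<subseteq> B" if "i \<in> B_indices" for i
    using chord_gap(2)[OF that] by (auto simp: gaps_def unoriented_def)
  have "chord j = chord k \<or> chord j = prod.swap (chord k)"
    using jk(3) by (auto simp: unoriented_def doubleton_eq_iff prod_eq_iff)
  moreover have "chord j \<noteq> prod.swap (chord k)"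
  proof
    assume *: "chord j = prod.swap (chord k)"
    have ne: "unoriented (chord j) \<noteq> {}" by (simp add: unoriented_def)
    consider "j \<in> A_indices" "k \<in> A_indices" | "j \<in> B_indices" "k \<in> B_indices"
      using jk sub sub' ne indices_partition(1) by blast
    then show False
    proof cases
      case 1
      then show False using chord_gap(1)[of j] chord_gap(1)[of k] * gaps_asym[OF card_A]
        by (cases "chord k") auto
    next
      case 2
      then show False using chord_gap(2)[of j] chord_gap(2)[of k] * gaps_asym[OF card_B]
        by (cases "chord k") auto
    qed
  qed
  ultimately show "j = k" using d_eq_iff jk by (auto simp: chord_def)
qed

text \<open>By \<open>chords_cross_iff\<close>, the chords cross if exactly one end of \<open>chord k\<close> lies between the ends of
  \<open>chord j\<close>. The starting point does so only for the next index, the end point only for the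
  previous one.\<close>
lemma cross_chord:
  assumes "j \<in> A_indices" "k \<in> B_indices"
  shows "chords_cross v (chord j) (chord k) \<longleftrightarrow> (k = nx j) \<noteq> (j = nx k)"
proof -
  have j: "j \<in> {1..R}" "d j \<in> A" "nx j \<in> {1..R}" and k: "k \<in> {1..R}" "d k \<in> B" "nx k \<in> {1..R}"
    using assms cyclic_succ_in by (auto simp: A_indices_def B_indices_def)
  note gj = d_gap[OF j(1)] and gk = d_gap[OF k(1)]
  note c = colours_at_gap[OF gj j(2)] and c' = complement.colours_at_gap[OF gk k(2)]
  have dist: "distinct [d j, s (d (nx j)), d k, s (d (nx k))]"
    using c c' j k by auto
  have "chords_cross v (chord j) (chord k) \<longleftrightarrow>
    clockwise (d j) (d k) (s (d (nx j))) \<noteq> clockwise (d j) (s (d (nx k))) (s (d (nx j)))"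
    unfolding chord_def using chords_cross_iff[OF c(1,3) c'(1,3) dist] .
  also have "clockwise (d j) (d k) (s (d (nx j))) \<longleftrightarrow> k = nx j"
    using change_between[OF gj j(2) d_in[OF k(1)]] k j d_eq_iff by auto
  also have "clockwise (d j) (s (d (nx k))) (s (d (nx j))) \<longleftrightarrow> j = nx k"
    using succ_change_between[OF gj j(2) d_in[OF k(3)]] c' k j d_eq_iff by auto
  finally show ?thesis .
qed

lemma nx_nx: "3 \<le> R \<Longrightarrow> j \<in> {1..R} \<Longrightarrow> nx (nx j) \<noteq> j"
  by (cases "j = R"; cases "Suc j = R") (auto simp: cyclic_succ_less)

lemma consecutive_edges_oriented:
  assumes "3 \<le> R" and j: "j \<in> {1..R}"
  shows "signed_area (edge_direction v (chord j)) (edge_direction v (chord (nx j))) < 0"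
proof -
  have nj: "nx j \<in> {1..R}" "nx (nx j) \<in> {1..R}" using j cyclic_succ_in by blast+
  have ne: "d (nx (nx j)) \<noteq> d j" using nx_nx[OF assms] d_eq_iff nj j by blast
  note g = d_gap[OF j] d_gap[OF nj(1)]
  have "clockwise (d j) (d (nx j)) (s (d (nx j))) \<and>
      clockwise (d j) (s (d (nx j))) (s (d (nx (nx j))))"
    using consecutive_gaps_clockwise[OF g(1) _ g(2) ne]
      complement.consecutive_gaps_clockwise[OF g(1) _ g(2) ne] d_range[OF j] by blast
  then show ?thesis
    unfolding chord_def using d_range[OF j] d_range[OF nj(1)] d_range[OF nj(2)] cyclic_succ_in
    by (intro crossing_oriented) auto
qed

text \<open>Every index \<open>j\<close> accounts for exactly one crossing, that of \<open>chord j\<close> with the next chord. As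
  the two directions form a negatively oriented basis, the crossing has sign \<open>+1\<close> exactly if the next
  chord is the higher one, that is, if \<open>j\<close> is a cyclic ascent of the heights \<open>g\<close>.\<close>
lemma crossing_sum_chord:
  assumes R: "3 \<le> R" and g: "inj_on g {1..R}"
    and h: "\<And>j k. j \<in> {1..R} \<Longrightarrow> k \<in> {1..R} \<Longrightarrow> h (unoriented (chord j)) (unoriented (chord k)) \<longleftrightarrow> g j > g k"
  shows "crossing_sum v h (chord ` A_indices) (chord ` B_indices) = 2 * int (card (cyclic_ascents R g)) - int R"
proof -
  let ?t = "\<lambda>j. if j \<in> cyclic_ascents R g then 1 else - 1 :: int"
  let ?f = "\<lambda>j. (chord j, chord (nx j))" and ?b = "\<lambda>k. (chord (nx k), chord k)"
  let ?sg = "\<lambda>(x, y). crossing_sign v h x y"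
  have chord_eq: "chord j = chord k \<longleftrightarrow> j = k" if "j \<in> {1..R}" "k \<in> {1..R}" for j k
    using inj_onD[OF inj_unoriented_chord _ that] by auto
  have R_in: "j \<in> {1..R}" if "j \<in> A_indices \<or> j \<in> B_indices" for j
    using that indices_partition(1) by blast
  have C: "{(x, y). x \<in> chord ` A_indices \<and> y \<in> chord ` B_indices \<and> chords_cross v x y} = ?f ` A_indices \<union> ?b ` B_indices"
  proof -
    \<comment> \<open>With at least three colour changes the two cases of \<open>cross_chord\<close> exclude each other.\<close>
    have cross: "chords_cross v (chord j) (chord k) \<longleftrightarrow> k = nx j \<or> j = nx k" if "j \<in> A_indices" "k \<in> B_indices" for j k
      using cross_chord[OF that] nx_nx[OF R, of j] R_in that by auto
    show ?thesis
    proof (intro equalityI subsetI)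
      fix p assume "p \<in> {(x, y). x \<in> chord ` A_indices \<and> y \<in> chord ` B_indices \<and> chords_cross v x y}"
      then obtain j k where "j \<in> A_indices" "k \<in> B_indices" "p = (chord j, chord k)" "chords_cross v (chord j) (chord k)"
        by blast
      then show "p \<in> ?f ` A_indices \<union> ?b ` B_indices" using cross by blast
    next
      fix p assume "p \<in> ?f ` A_indices \<union> ?b ` B_indices"
      then obtain j k where "j \<in> A_indices" "k \<in> B_indices" "p = (chord j, chord k)" "k = nx j \<or> j = nx k"
        using nx_A_indices nx_B_indices by blast
      then show "p \<in> {(x, y). x \<in> chord ` A_indices \<and> y \<in> chord ` B_indices \<and> chords_cross v x y}"
        using cross by blast
    qed
  qed
  have sign: "?sg (?f j) = ?t j \<and> ?sg (?b j) = ?t j" if j: "j \<in> {1..R}" for j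
  proof -
    have nj: "nx j \<in> {1..R}" using j cyclic_succ_in by blast
    have "nx j \<noteq> j" using nx_nx[OF R j] by metis
    then have "g j \<noteq> g (nx j)" using g j nj by (metis inj_onD)
    moreover have "over_under_sign v (chord j) (chord (nx j)) = -1" "over_under_sign v (chord (nx j)) (chord j) = 1"
      using consecutive_edges_oriented[OF R j] signed_area_commute[of "edge_direction v (chord j)" "edge_direction v (chord (nx j))"]
      by (auto intro: over_under_sign_eq)
    ultimately show ?thesis
      using h[OF j nj] h[OF nj j] j by (auto simp: crossing_sign_def cyclic_ascents_def)
  qed
  have inj_f: "inj_on ?f A_indices" and inj_b: "inj_on ?b B_indices"
    using chord_eq R_in by (auto intro!: inj_onI)
  have disj: "?f ` A_indices \<inter> ?b ` B_indices = {}"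
  proof -
    have False if "j \<in> A_indices" "k \<in> B_indices" "?f j = ?b k" for j k
    proof -
      have "j = nx k" "nx j = k"
        using that chord_eq R_in nx_A_indices nx_B_indices by auto
      then show False using nx_nx[OF R, of k] R_in that by blast
    qed
    then show ?thesis by blast
  qed
  have "crossing_sum v h (chord ` A_indices) (chord ` B_indices) = sum ?sg (?f ` A_indices \<union> ?b ` B_indices)"
    unfolding crossing_sum_def C ..
  also have "\<dots> = sum ?sg (?f ` A_indices) + sum ?sg (?b ` B_indices)"
    using indices_partition disj by (intro sum.union_disjoint) auto
  also have "\<dots> = (\<Sum>j\<in>A_indices. ?sg (?f j)) + (\<Sum>k\<in>B_indices. ?sg (?b k))"
    by (simp only: sum.reindex[OF inj_f] sum.reindex[OF inj_b] o_def)
  also have "\<dots> = sum ?t A_indices + sum ?t B_indices"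
    using sign R_in by (intro arg_cong2[where f = "(+)"] sum.cong) blast+
  also have "\<dots> = sum ?t {1..R}"
    using indices_partition by (simp add: sum.union_disjoint)
  also have "\<dots> = (\<Sum>j\<in>{1..R}. 2 * (if j \<in> cyclic_ascents R g then 1 else 0) - 1)"
    by (intro sum.cong) auto
  also have "\<dots> = 2 * int (card ({1..R} \<inter> cyclic_ascents R g)) - int R"
    by (simp add: sum_subtractf sum_distrib_left[symmetric] sum.If_cases)
  also have "{1..R} \<inter> cyclic_ascents R g = cyclic_ascents R g"
    by (auto simp: cyclic_ascents_def)
  finally show ?thesis .
qed

lemma crossings_transversal:
  assumes "x \<in> chord ` A_indices" "y \<in> chord ` B_indices" "chords_cross v x y"
  shows "signed_area (edge_direction v x) (edge_direction v y) \<noteq> 0"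
proof -
  obtain a b where x: "x = (a, b)" by (cases x)
  obtain c d' where y: "y = (c, d')" by (cases y)
  have "x \<in> gaps A" "y \<in> gaps B" using assms chord_gap by auto
  then have "a \<in> A" "b \<in> A" "a \<noteq> b" "c \<in> B" "d' \<in> B" "c \<noteq> d'"
    by (auto simp: x y gaps_def)
  then show ?thesis
    using assms(3) A_sub unfolding x y by (intro crossing_transversal) auto
qed

end

section \<open>Distribution of the linking number\<close>

lemma linking_number_crossing_sum:
  "linking_number N v h P Q = real_of_int (crossing_sum v h
      {d \<in> oriented_edges P. unoriented d \<in> interior_edges N}
      {d \<in> oriented_edges Q. unoriented d \<in> interior_edges N}) / 2"
proof -
  have "cycle_crossings N v P Q = {(d, f). d \<in> {d \<in> oriented_edges P. unoriented d \<in> interior_edges N}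
     \<and> f \<in> {d \<in> oriented_edges Q. unoriented d \<in> interior_edges N} \<and> chords_cross v d f}"
    by (auto simp: cycle_crossings_def)
  then show ?thesis by (simp add: linking_number_def crossing_sum_def)
qed

lemma interior_swap:
  "{d \<in> prod.swap ` X. unoriented d \<in> I} = prod.swap ` {d \<in> X. unoriented d \<in> I}"
  by (auto simp: unoriented_swap image_iff) (metis (no_types, lifting) mem_Collect_eq swap_simp unoriented_swap)+

lemma cycle_interior_edges_eq:
  assumes "oriented_edges c = X \<or> oriented_edges c = prod.swap ` X"
  shows "cycle_interior_edges N c = unoriented ` {d \<in> X. unoriented d \<in> interior_edges N}"
proof -
  have "unoriented ` oriented_edges c = unoriented ` X"
    using assms by (elim disjE) (simp_all add: image_image unoriented_swap)
  then show ?thesis by (auto simp: cycle_interior_edges_def)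
qed

lemma lies_above_iff:
  assumes "inj_on e {1..num_interior N}" "a \<in> {1..num_interior N}" "b \<in> {1..num_interior N}"
  shows "lies_above N e \<sigma> (e a) (e b) \<longleftrightarrow> \<sigma> a > \<sigma> b"
proof
  assume "lies_above N e \<sigma> (e a) (e b)"
  then obtain x y where "x \<in> {1..num_interior N}" "y \<in> {1..num_interior N}"
    "e a = e x" "e b = e y" "\<sigma> x > \<sigma> y"
    unfolding lies_above_def by blast
  then show "\<sigma> a > \<sigma> b" using assms inj_onD[OF assms(1)] by metis
qed (use assms in \<open>auto simp only: lies_above_def\<close>)

context enumerated_diagram
begin

text \<open>A decreasing cycle is an increasing one with all edges reversed. So \<open>\<epsilon>\<close> is \<open>1\<close> if
  the two cycles run in the same direction, and \<open>-1\<close> otherwise.\<close>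
lemma linking_number_monotonic:
  assumes P: "oriented_edges P = gaps A \<or> oriented_edges P = prod.swap ` gaps A"
    and Q: "oriented_edges Q = gaps B \<or> oriented_edges Q = prod.swap ` gaps B"
  obtains \<epsilon> :: int where "\<epsilon> = 1 \<or> \<epsilon> = -1"
    and "\<And>h. linking_number N v h P Q = \<epsilon> * crossing_sum v h (chord ` A_indices) (chord ` B_indices) / 2"
proof -
  let ?I = "\<lambda>X. {d \<in> X. unoriented d \<in> interior_edges N}"
  have P': "?I (oriented_edges P) = chord ` A_indices \<or> ?I (oriented_edges P) = prod.swap ` chord ` A_indices"
    using P by (elim disjE) (simp_all only: interior_swap interior_gaps_A simp_thms)
  have Q': "?I (oriented_edges Q) = chord ` B_indices \<or> ?I (oriented_edges Q) = prod.swap ` chord ` B_indices"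
    using Q by (elim disjE) (simp_all only: interior_swap interior_gaps_B simp_thms)
  have tr: "signed_area (edge_direction v x) (edge_direction v y) \<noteq> 0"
    if "x \<in> chord ` A_indices" "y \<in> chord ` B_indices" "chords_cross v x y" for x y
    using crossings_transversal that .
  have tr': "signed_area (edge_direction v x) (edge_direction v y) \<noteq> 0"
    if "x \<in> chord ` A_indices" "y \<in> prod.swap ` chord ` B_indices" "chords_cross v x y" for x y
  proof -
    obtain z where "z \<in> chord ` B_indices" "y = prod.swap z" using \<open>y \<in> prod.swap ` chord ` B_indices\<close> by blast
    then show ?thesis using tr[of x z] that
      by (simp only: chords_cross_swap edge_direction_swap signed_area_minus) simp
  qed
  note sw = crossing_sum_swap[of "chord ` A_indices" "chord ` B_indices" v, OF tr]
    crossing_sum_swap(1)[of "chord ` A_indices" "prod.swap ` chord ` B_indices" v, OF tr']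
  have "\<exists>\<epsilon>::int. (\<epsilon> = 1 \<or> \<epsilon> = -1) \<and> (\<forall>h. crossing_sum v h (?I (oriented_edges P)) (?I (oriented_edges Q))
      = \<epsilon> * crossing_sum v h (chord ` A_indices) (chord ` B_indices))"
    using P' Q'
  proof (elim disjE)
    assume "?I (oriented_edges P) = chord ` A_indices" "?I (oriented_edges Q) = chord ` B_indices"
    then show ?thesis by (intro exI[of _ 1]) simp
  next
    assume "?I (oriented_edges P) = chord ` A_indices" "?I (oriented_edges Q) = prod.swap ` chord ` B_indices"
    then show ?thesis using sw by (intro exI[of _ "-1"]) simp
  next
    assume "?I (oriented_edges P) = prod.swap ` chord ` A_indices" "?I (oriented_edges Q) = chord ` B_indices"
    then show ?thesis using sw by (intro exI[of _ "-1"]) simp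
  next
    assume "?I (oriented_edges P) = prod.swap ` chord ` A_indices" "?I (oriented_edges Q) = prod.swap ` chord ` B_indices"
    then show ?thesis using sw by (intro exI[of _ 1]) simp
  qed
  then obtain \<epsilon> :: int where "\<epsilon> = 1 \<or> \<epsilon> = -1"
    and "\<And>h. crossing_sum v h (?I (oriented_edges P)) (?I (oriented_edges Q))
      = \<epsilon> * crossing_sum v h (chord ` A_indices) (chord ` B_indices)"
    by blast
  then show ?thesis by (intro that[of \<epsilon>]) (simp_all add: linking_number_crossing_sum)
qed

lemma card_cycle_interior_edges_A:
  assumes "oriented_edges P = gaps A \<or> oriented_edges P = prod.swap ` gaps A"
  shows "card (cycle_interior_edges N P) = card A_indices"
proof -
  have "cycle_interior_edges N P = unoriented ` {d \<in> gaps A. unoriented d \<in> interior_edges N}"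
    using assms by (rule cycle_interior_edges_eq)
  then have "cycle_interior_edges N P = (\<lambda>j. unoriented (chord j)) ` A_indices"
    by (simp only: interior_gaps_A image_image)
  then show ?thesis
    using inj_unoriented_chord indices_partition(1) by (metis card_image inj_on_subset Un_upper1)
qed

lemma card_cycle_interior_edges_B:
  assumes "oriented_edges Q = gaps B \<or> oriented_edges Q = prod.swap ` gaps B"
  shows "card (cycle_interior_edges N Q) = card B_indices"
proof -
  have "cycle_interior_edges N Q = unoriented ` {d \<in> gaps B. unoriented d \<in> interior_edges N}"
    using assms by (rule cycle_interior_edges_eq)
  then have "cycle_interior_edges N Q = (\<lambda>j. unoriented (chord j)) ` B_indices"
    by (simp only: interior_gaps_B image_image)
  then show ?thesis
    using inj_unoriented_chord indices_partition(1) by (metis card_image inj_on_subset Un_upper2)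
qed

end

theorem corollary6:
  fixes m n i :: nat and P Q :: "nat list" and l :: int
    and v :: "nat \<Rightarrow> complex" and e :: "nat \<Rightarrow> nat set"
  assumes "m \<ge> 3" and "n \<ge> 3" and "i \<ge> 2"
    and "clockwise_on_circle (m + n) v"
    and "bij_betw e {1..num_interior (m + n)} (interior_edges (m + n))"
    and "is_cycle (m + n) P" and "length P = m" and "monotonic_cycle P"
    and "is_cycle (m + n) Q" and "length Q = n" and "monotonic_cycle Q"
    and "set P \<inter> set Q = {}"
    and "card (cycle_interior_edges (m + n) P) = i"
    and "card (cycle_interior_edges (m + n) Q) = i"
  shows "measure_pmf.prob (pmf_of_set (height_permutations (m + n)))
           {\<sigma>. linking_number (m + n) v (lies_above (m + n) e \<sigma>) P Q = of_int l}
         = real (eulerian (2 * i - 1) (int i + l - 1)) / fact (2 * i - 1)"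
proof -
  define N where "N = m + n"
  define A where "A = set P"
  define M where "M = num_interior N"
  note asm = assms[folded N_def M_def]
  have PQ: "distinct P" "set P \<subseteq> {1..N}" "distinct Q" "set Q \<subseteq> {1..N}"
    using asm by (auto simp: is_cycle_def)
  have cards: "card (set P) = m" "card (set Q) = n"
    using PQ asm by (simp_all add: distinct_card)
  have "card (set P \<union> set Q) = card {1..N}"
    using cards asm by (simp add: card_Un_disjoint N_def)
  then have "set P \<union> set Q = {1..N}"
    using PQ by (intro card_subset_eq) auto
  then have B: "{1..N} - A = set Q" using asm(12) by (auto simp: A_def)
  interpret circular_diagram N v by unfold_locales (rule asm(4))
  interpret two_colouring N A
    by unfold_locales (use PQ cards asm in \<open>auto simp: A_def\<close>)
  have P: "oriented_edges P = gaps A \<or> oriented_edges P = prod.swap ` gaps A"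
    unfolding A_def using monotonic_cycle_edges asm by blast
  have Q: "oriented_edges Q = gaps ({1..N} - A) \<or> oriented_edges Q = prod.swap ` gaps ({1..N} - A)"
    unfolding B using monotonic_cycle_edges asm by blast
  have "cycle_interior_edges N P \<noteq> {}" using asm by auto
  then have "{d \<in> gaps A. unoriented d \<in> interior_edges N} \<noteq> {}"
    using cycle_interior_edges_eq[OF P] by auto
  then obtain x y where xy: "(x, y) \<in> gaps D" unfolding interior_gaps by blast
  have "card {x, y} \<le> card D"
    using xy by (intro card_mono) (auto simp: gaps_def colour_changes_def)
  then have "2 \<le> card D" using xy by (auto simp: gaps_def)
  then obtain d where d: "bij_betw d {1..card D} D"
    "gaps D = (\<lambda>j. (d j, d (cyclic_succ (card D) j))) ` {1..card D}"
    using gaps_enumeration by blast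
  interpret enumerated_diagram N v A d "card D"
    by unfold_locales (use B cards asm d in auto)
  define r where "r = 2 * i - 1"
  have "card A_indices = i" "card B_indices = i"
    using card_cycle_interior_edges_A[OF P] card_cycle_interior_edges_B[OF Q] asm by simp_all
  moreover have "card (A_indices \<union> B_indices) = card D"
    using indices_partition(1) by (metis card_atLeastAtMost diff_Suc_1)
  ultimately have "card D = 2 * i"
    using indices_partition by (simp add: card_Un_disjoint)
  then have R: "card D = Suc r" "1 \<le> r" "3 \<le> card D" using asm(3) by (auto simp: r_def)
  \<comment> \<open>The label of the sheet that contains the \<open>j\<close>-th chord.\<close>
  define b where "b j = inv_into {1..M} e (unoriented (chord j))" for j
  have eb: "e (b j) = unoriented (chord j)" "b j \<in> {1..M}" if "j \<in> {1..Suc r}" for j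
  proof -
    have "unoriented (chord j) \<in> e ` {1..M}"
      using chord_interior[of j] that R asm(5) by (simp add: bij_betw_def)
    then show "e (b j) = unoriented (chord j)" "b j \<in> {1..M}"
      unfolding b_def by (rule f_inv_into_f, rule inv_into_into)
  qed
  have inj_b: "inj_on b {1..Suc r}"
    using inj_unoriented_chord eb unfolding R(1) inj_on_def by metis
  have inj_e: "inj_on e {1..M}" using asm(5) by (simp add: bij_betw_def)
  obtain \<epsilon> :: int where \<epsilon>: "\<epsilon> = 1 \<or> \<epsilon> = -1"
    and link: "\<And>h. linking_number N v h P Q = \<epsilon> * crossing_sum v h (chord ` A_indices) (chord ` B_indices) / 2"
    using linking_number_monotonic[OF P Q] by metis
  let ?L = "\<lambda>\<sigma>. linking_number N v (lies_above N e \<sigma>) P Q"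
  have event: "?L \<sigma> = of_int l \<longleftrightarrow> int (card (cyclic_ascents (Suc r) (\<sigma> \<circ> b))) = int i + \<epsilon> * l"
    if \<sigma>: "\<sigma> permutes {1..M}" for \<sigma>
  proof -
    have "lies_above N e \<sigma> (unoriented (chord j)) (unoriented (chord k)) \<longleftrightarrow> (\<sigma> \<circ> b) j > (\<sigma> \<circ> b) k"
      if "j \<in> {1..card D}" "k \<in> {1..card D}" for j k
    proof -
      have jk: "b j \<in> {1..M}" "b k \<in> {1..M}" "unoriented (chord j) = e (b j)" "unoriented (chord k) = e (b k)"
        using eb that R(1) by auto
      show ?thesis
        using lies_above_iff[of e N "b j" "b k", folded M_def, OF inj_e jk(1,2)] by (simp only: jk(3,4) o_apply)
    qed
    moreover have "inj_on (\<sigma> \<circ> b) {1..card D}"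
      unfolding R(1) by (rule comp_inj_on[OF inj_b permutes_inj_on[OF \<sigma>]])
    ultimately have "crossing_sum v (lies_above N e \<sigma>) (chord ` A_indices) (chord ` B_indices)
        = 2 * int (card (cyclic_ascents (Suc r) (\<sigma> \<circ> b))) - 2 * int i"
      using crossing_sum_chord[OF R(3)] \<open>card D = 2 * i\<close> R(1) by simp
    then have cs: "crossing_sum v (lies_above N e \<sigma>) (chord ` A_indices) (chord ` B_indices)
        = 2 * (int (card (cyclic_ascents (Suc r) (\<sigma> \<circ> b))) - int i)"
      by (simp only: right_diff_distrib)
    have "?L \<sigma> = of_int (\<epsilon> * (int (card (cyclic_ascents (Suc r) (\<sigma> \<circ> b))) - int i))"
      unfolding link cs by simp
    then have "?L \<sigma> = of_int l \<longleftrightarrow> \<epsilon> * (int (card (cyclic_ascents (Suc r) (\<sigma> \<circ> b))) - int i) = l"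
      by (simp only: of_int_eq_iff)
    also have "\<dots> \<longleftrightarrow> int (card (cyclic_ascents (Suc r) (\<sigma> \<circ> b))) = int i + \<epsilon> * l"
      using \<epsilon> by auto
    finally show ?thesis .
  qed
  have hp: "height_permutations N = {\<sigma>. \<sigma> permutes {1..M}}"
    by (simp add: height_permutations_def M_def)
  have "{\<sigma>. \<sigma> permutes {1..M}} \<noteq> {}" using permutes_id by blast
  then have "set_pmf (pmf_of_set (height_permutations N)) = {\<sigma>. \<sigma> permutes {1..M}}"
    unfolding hp by (simp add: finite_permutations)
  then have "{\<sigma>. ?L \<sigma> = of_int l} \<inter> set_pmf (pmf_of_set (height_permutations N))
    = {\<sigma>. int (card (cyclic_ascents (Suc r) (\<sigma> \<circ> b))) = int i + \<epsilon> * l}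
      \<inter> set_pmf (pmf_of_set (height_permutations N))"
    using event by auto
  then have "measure_pmf.prob (pmf_of_set (height_permutations N)) {\<sigma>. ?L \<sigma> = of_int l}
    = measure_pmf.prob (pmf_of_set (height_permutations N))
        {\<sigma>. int (card (cyclic_ascents (Suc r) (\<sigma> \<circ> b))) = int i + \<epsilon> * l}"
    by (metis measure_Int_set_pmf)
  also have "\<dots> = real (eulerian r (int i + \<epsilon> * l - 1)) / fact r"
    unfolding hp using inj_b eb(2) R(2) by (intro prob_cyclic_ascents) auto
  also have "eulerian r (int i + \<epsilon> * l - 1) = eulerian r (int i + l - 1)"
  proof (cases "\<epsilon> = 1")
    case False
    then have "int i + \<epsilon> * l - 1 = int r - 1 - (int i + l - 1)"
      using \<epsilon> asm(3) by (auto simp: r_def)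
    then show ?thesis using eulerian_symmetric[OF R(2), of "int i + l - 1"] by (simp only:)
  qed simp
  finally show ?thesis unfolding N_def r_def .
qed

end
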